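(* For $I=(I_1,\dots,I_N)\in\mathcal I_n$, the vector $$\xi_I=\ell^+(w_{I_N})^{\{N\}}_{\{N-1\}}\;\ell^+(w_{I_{N-1}\cup I_N})^{\{N-1,N\}}_{\{N-2,N\}}\cdots\ell^+(w_{I_2\cup\cdots\cup I_N})^{\{2,\dots,N\}}_{\{1,3,\dots,N\}}\cdot\zeta$$ and the vector $$\widetilde\xi_I=L^+_{N-1,N}(w_{I_N})L^+_{N-2,N-1}(w_{I_{N-1}\cup I_N})\cdots L^+_{12}(w_{I_2\cup\cdots\cup I_N})\cdot\zeta$$ in $\mathcal V=\widehat V_{w_1}\widetilde\otimes\cdots\widetilde\otimes\widehat V_{w_n}$ are related by $$\xi_I=\prod_{j=1}^n\prod_{l=1}^{N-1}\prod_{a=1}^{N-l-1}\theta\big(q^{-2a}w_{I_{l+1}\cup\cdots\cup I_N}/w_j\big)\;\widetilde\xi_I,$$ where $\theta(q^{-2a}w_S/w_j)=\prod_{s\in S}\theta(q^{-2a}w_s/w_j)$.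
   Context: Notation. $q,p\in\mathbb C^\times$ generic, $|q|,|p|<1$; $(x;p)_\infty=\prod_{n\ge0}(1-xp^n)$, $\Theta_p(z)=(z;p)_\infty(p/z;p)_\infty(p;p)_\infty$, $\theta(z)=-z^{-1/2}\Theta_p(z)$. $\mathbb F$: field of meromorphic functions of the dynamical variables $P_{\epsilon_1},\dots,P_{\epsilon_N}$; $\Pi^*_{j,k}=q^{2(P_{\epsilon_j}-P_{\epsilon_k})}$. The matrix $\widetilde R(z,\Pi^* )=\sum\widetilde R(z,\Pi^* )_{i\mu}^{j\nu}E_{ij}\otimes E_{\mu\nu}$ is $\widetilde R(z,\Pi^* )=\sum_j\theta(q^2z)E_{jj}\otimes E_{jj}+\sum_{j<k}\Big(\frac{\theta(q^2\Pi^*_{j,k})\theta(q^{-2}\Pi^*_{j,k})\theta(z)}{\theta(\Pi^*_{j,k})^2}E_{jj}\otimes E_{kk}+\theta(z)E_{kk}\otimes E_{jj}+\frac{\theta(q^2)\theta(z\Pi^*_{j,k})}{\theta(\Pi^*_{j,k})}E_{jk}\otimes E_{kj}+\frac{\theta(q^2)\theta(z/\Pi^*_{j,k})}{\theta(1/\Pi^*_{j,k})}E_{kj}\otimes E_{jk}\Big)$. Tensor product of vector representations. Let $\widehat V=\bigoplus_{\mu=1}^N\mathbb Fv_\mu$, $w_1,\dots,w_n\in\mathbb C^\times$ generic, and $\mathcal V=\widehat V_{w_1}\widetilde\otimes\cdots\widetilde\otimes\widehat V_{w_n}$, the $\mathbb F$-vector space with basis $v_{\boldsymbol\mu}=v_{\mu_1}\widetilde\otimes\cdots\widetilde\otimes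 v_{\mu_n}$, $\boldsymbol\mu\in[1,N]^n$. Write $\widetilde R^{(0n)}(z/w_n,\Pi^*q^{2\sum_{j=1}^{n-1}h^{(j)}})\cdots\widetilde R^{(02)}(z/w_2,\Pi^*q^{2h^{(1)}})\widetilde R^{(01)}(z/w_1,\Pi^* )=\sum_{k,l}E_{kl}\otimes T_{kl}(z;\Pi^* )$, where $0$ labels an auxiliary copy of $\mathbb C^N$ and $q^{2h^{(i)}}$ multiplies $\Pi^*_{j,k}$ by $q^{2(\delta_{\beta j}-\delta_{\beta k})}$ on vectors with $v_\beta$ in the $i$-th tensor factor. The $L$-operators act by $L^+_{kl}(z)(f(P)v_{\boldsymbol\alpha})=f(P+\epsilon_l)\,T_{kl}(z;\Pi^* )v_{\boldsymbol\alpha}$, where $f(P+\epsilon_l)$ means $P_{\epsilon_i}\mapsto P_{\epsilon_i}+\delta_{il}$ (so $\Pi^*_{i,j}\mapsto\Pi^*_{i,j}q^{2(\delta_{li}-\delta_{lj})}$). Put $\zeta=v_{(1,\dots,1)}$. Quantum minors. For row set $R=\{i_1<\dots<i_k\}$ and column set $J=\{j_1<\dots<j_k\}$: $\ell^+(z)_R^J=\sum_{\sigma\in\mathfrak S_k}\mathrm{sgn}^*_J(\sigma,\Pi^* )L^+_{i_1j_{\sigma(1)}}(z)L^+_{i_2j_{\sigma(2)}}(q^{-2}z)\cdots L^+_{i_kj_{\sigma(k)}}(q^{-2(k-1)}z)$, $\mathrm{sgn}^*_J(\sigma,\Pi^* )=\prod_{a<b,\ \sigma(a)>\sigma(b)}\frac{\theta(q^2\Pi^*_{j_{\sigma(a)},j_{\sigma(b)}})}{\theta(\Pi^*_{j_{\sigma(b)},j_{\sigma(a)}})}$.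 $\mathcal I_n$: set of all ordered partitions $I=(I_1,\dots,I_N)$ of $[1,n]=\{1,\dots,n\}$ into disjoint (possibly empty) subsets. For $S=\{s_1<\dots<s_r\}$ and any operator $X(z)$ put $X(w_S)=X(w_{s_r})\cdots X(w_{s_1})$. ($\xi_I$ is the specialization to $\mathcal V$ of the Gelfand–Tsetlin vectors built from quantum minors, i.e. from the Drinfeld generators.) *)

theory Defs
  imports
    "HOL-Complex_Analysis.Complex_Analysis"
    "HOL-Combinatorics.Permutations"
begin

section \<open>The field of meromorphic functions on a complex coordinate space\<close>

definition holo_on :: "(complex^'n::finite \<Rightarrow> complex) \<Rightarrow> (complex^'n) set \<Rightarrow> bool" where
  "holo_on f U \<longleftrightarrow>
     (\<forall>x\<in>U. \<exists>D. (f has_derivative D) (at x) \<and> (\<forall>c v. D (c *s v) = c * D v))"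

definition nowhere_dense :: "'a::topological_space set \<Rightarrow> bool" where
  "nowhere_dense S \<longleftrightarrow> interior (closure S) = {}"

text \<open>
  Representatives of meromorphic functions are total functions that are locally quotients of
  holomorphic functions. Their values at zeros of the local denominators are irrelevant, and two
  representatives are identified if they differ only on a nowhere dense set.
\<close>

definition mero_at :: "(complex^'n::finite \<Rightarrow> complex) \<Rightarrow> complex^'n \<Rightarrow> bool" where
  "mero_at f a \<longleftrightarrow> (\<exists>U g h. open U \<and> a \<in> U \<and> holo_on g U \<and> holo_on h U \<and>
     interior {x\<in>U. h x = 0} = {} \<and> (\<forall>x\<in>U. h x \<noteq> 0 \<longrightarrow> f x = g x / h x))"

definition is_mero :: "(complex^'n::finite \<Rightarrow> complex) \<Rightarrow> bool" where
  "is_mero f \<longleftrightarrow> (\<forall>a. mero_at f a)"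

definition mero_eq :: "(complex^'n::finite \<Rightarrow> complex) \<Rightarrow> (complex^'n \<Rightarrow> complex) \<Rightarrow> bool" where
  "mero_eq f g \<longleftrightarrow> is_mero f \<and> is_mero g \<and> nowhere_dense {x. f x \<noteq> g x}"

lemma nowhere_dense_subset: "nowhere_dense T \<Longrightarrow> S \<subseteq> T \<Longrightarrow> nowhere_dense S"
  unfolding nowhere_dense_def by (metis closure_mono interior_mono subset_empty)

lemma nowhere_dense_Un: "nowhere_dense S \<Longrightarrow> nowhere_dense T \<Longrightarrow> nowhere_dense (S \<union> T)"
  unfolding nowhere_dense_def closure_Un
  by (simp add: interior_closed_Un_empty_interior)

lemma nowhere_dense_empty [simp]: "nowhere_dense {}"
  by (simp add: nowhere_dense_def)

lemma nowhere_dense_not_open: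
  assumes "nowhere_dense S" "open W" "W \<subseteq> S"
  shows "W = {}"
  using assms unfolding nowhere_dense_def
  by (metis closure_subset interior_maximal order_trans subset_empty)

lemma nowhere_dense_locally:
  assumes "\<And>a. \<exists>V. open V \<and> a \<in> V \<and> nowhere_dense (V \<inter> S)"
  shows "nowhere_dense S"
  unfolding nowhere_dense_def
proof (rule ccontr)
  assume "interior (closure S) \<noteq> {}"
  then obtain a where a: "a \<in> interior (closure S)" by blast
  obtain V where V: "open V" "a \<in> V" "nowhere_dense (V \<inter> S)" using assms by blast
  have "V \<inter> interior (closure S) \<subseteq> closure (V \<inter> S)"
    using open_Int_closure_subset[OF V(1), of S] interior_subset[of "closure S"] by blast
  then have "V \<inter> interior (closure S) \<subseteq> interior (closure (V \<inter> S))"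
    by (intro interior_maximal) (auto simp: V)
  then show False using a V unfolding nowhere_dense_def by blast
qed

lemma holo_on_subset: "holo_on f U \<Longrightarrow> V \<subseteq> U \<Longrightarrow> holo_on f V"
  unfolding holo_on_def by blast

lemma holo_on_const [simp]: "holo_on (\<lambda>_. c) U"
  unfolding holo_on_def by (auto intro!: exI[of _ "\<lambda>_. 0"])

lemma holo_on_add:
  assumes "holo_on f U" "holo_on g U" shows "holo_on (\<lambda>x. f x + g x) U"
  unfolding holo_on_def
proof
  fix x assume "x \<in> U"
  then obtain D E where D: "(f has_derivative D) (at x)" "\<forall>c v. D (c *s v) = c * D v"
    and E: "(g has_derivative E) (at x)" "\<forall>c v. E (c *s v) = c * E v"
    using assms unfolding holo_on_def by meson
  show "\<exists>D. ((\<lambda>x. f x + g x) has_derivative D) (at x) \<and> (\<forall>c v. D (c *s v) = c * D v)"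
    using has_derivative_add[OF D(1) E(1)] D(2) E(2)
    by (intro exI[of _ "\<lambda>v. D v + E v"]) (auto simp: algebra_simps)
qed

lemma holo_on_mult:
  assumes "holo_on f U" "holo_on g U" shows "holo_on (\<lambda>x. f x * g x) U"
  unfolding holo_on_def
proof
  fix x assume "x \<in> U"
  then obtain D E where D: "(f has_derivative D) (at x)" "\<forall>c v. D (c *s v) = c * D v"
    and E: "(g has_derivative E) (at x)" "\<forall>c v. E (c *s v) = c * E v"
    using assms unfolding holo_on_def by meson
  show "\<exists>D. ((\<lambda>x. f x * g x) has_derivative D) (at x) \<and> (\<forall>c v. D (c *s v) = c * D v)"
    using has_derivative_mult[OF D(1) E(1)] D(2) E(2)
    by (intro exI[of _ "\<lambda>v. f x * E v + D v * g x"]) (auto simp: algebra_simps)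
qed

lemma holo_on_continuous: "holo_on f U \<Longrightarrow> continuous_on U f"
  unfolding holo_on_def
  by (meson continuous_at_imp_continuous_on has_derivative_continuous)

lemma holo_on_shift:
  assumes "holo_on f U" shows "holo_on (\<lambda>x. f (x + a)) ((\<lambda>x. x + a) -` U)"
  unfolding holo_on_def
proof
  fix x assume "x \<in> (\<lambda>x. x + a) -` U"
  then obtain D where D: "(f has_derivative D) (at (x + a))" "\<forall>c v. D (c *s v) = c * D v"
    using assms unfolding holo_on_def by auto
  have "((\<lambda>x. x + a) has_derivative (\<lambda>v. v)) (at x)"
    by (auto intro!: derivative_eq_intros)
  from has_derivative_compose[OF this D(1)]
  show "\<exists>D. ((\<lambda>x. f (x + a)) has_derivative D) (at x) \<and> (\<forall>c v. D (c *s v) = c * D v)"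
    using D(2) by auto
qed

lemma open_nonzeros:
  assumes "holo_on f U" "open U" shows "open {x\<in>U. f x \<noteq> 0}"
proof -
  have "{x\<in>U. f x \<noteq> 0} = U \<inter> f -` (- {0})" by auto
  then show ?thesis
    using continuous_open_preimage[OF holo_on_continuous[OF assms(1)] assms(2) open_Compl[OF closed_singleton[of 0]]]
    by simp
qed

lemma nowhere_dense_zeros:
  assumes "holo_on f U" "open U" "interior {x\<in>U. f x = 0} = {}"
  shows "nowhere_dense {x\<in>U. f x = 0}"
  unfolding nowhere_dense_def
proof (rule ccontr)
  let ?Z = "{x\<in>U. f x = 0}"
  assume "interior (closure ?Z) \<noteq> {}"
  then obtain W where W: "open W" "W \<noteq> {}" "W \<subseteq> closure ?Z"
    by (metis interior_subset open_interior)
  have "W \<inter> ?Z \<noteq> {}" using W open_Int_closure_eq_empty[of W ?Z] by blast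
  then have ne: "W \<inter> U \<noteq> {}" by blast
  have "W \<inter> U \<inter> {x\<in>U. f x \<noteq> 0} \<inter> ?Z = {}" by blast
  moreover have o: "open (W \<inter> U \<inter> {x\<in>U. f x \<noteq> 0})"
    using W assms open_nonzeros[OF assms(1,2)] by blast
  ultimately have "W \<inter> U \<inter> {x\<in>U. f x \<noteq> 0} \<inter> closure ?Z = {}"
    using open_Int_closure_eq_empty by blast
  then have "W \<inter> U \<subseteq> ?Z" using W by blast
  moreover have "open (W \<inter> U)" using W assms by blast
  ultimately have "W \<inter> U \<subseteq> interior ?Z" by (simp add: interior_maximal)
  then show False using ne assms(3) by blast
qed

lemma holo_identity:
  fixes f :: "complex^'n::finite \<Rightarrow> complex"
  assumes f: "holo_on f (ball a r)" and W: "open W" "W \<noteq> {}" "W \<subseteq> ball a r"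
    and z: "\<And>x. x \<in> W \<Longrightarrow> f x = 0" and y: "y \<in> ball a r"
  shows "f y = 0"
proof -
  obtain w where w: "w \<in> W" using W by blast
  define L where "L = (\<lambda>t. w + t *s (y - w))"
  have lin: "linear (\<lambda>t::complex. t *s (y - w))"
    by (intro linearI) (auto simp: vec_eq_iff algebra_simps)
  then have bl: "bounded_linear (\<lambda>t::complex. t *s (y - w))"
    using linear_conv_bounded_linear by blast
  have dL: "(L has_derivative (\<lambda>t. t *s (y - w))) (at t)" for t
    unfolding L_def using has_derivative_add[OF has_derivative_const bounded_linear.has_derivative[OF bl has_derivative_ident]]
    by simp
  have cL: "continuous_on UNIV L"
    by (intro continuous_at_imp_continuous_on ballI has_derivative_continuous[OF dL])
  define S where "S = L -` ball a r"
  define T where "T = L -` W"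
  have oS: "open S" and oT: "open T"
    unfolding S_def T_def using cL W by (auto intro: open_vimage)
  have "convex S"
  proof -
    have "S = (\<lambda>t. t *s (y - w)) -` ((\<lambda>x. x - w) ` ball a r)"
      unfolding S_def L_def by (force simp: image_iff algebra_simps)
    moreover have "convex ((\<lambda>x. x - w) ` ball a r)"
      using convex_translation_subtract convex_ball by blast
    ultimately show ?thesis using convex_linear_vimage[OF lin] by simp
  qed
  then have cS: "connected S" by (rule convex_connected)
  have hol: "(\<lambda>t. f (L t)) holomorphic_on S"
    unfolding holomorphic_on_def
  proof
    fix t assume "t \<in> S"
    then obtain D where D: "(f has_derivative D) (at (L t))" "\<forall>c v. D (c *s v) = c * D v"
      using f \<open>t \<in> S\<close> unfolding holo_on_def S_def by (metis vimageE)
    have "((\<lambda>t. f (L t)) has_derivative (\<lambda>s. D (s *s (y - w)))) (at t)"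
      using has_derivative_compose[OF dL D(1)] by simp
    moreover have "(\<lambda>s. D (s *s (y - w))) = (*) (D (y - w))"
      using D(2) by (simp add: fun_eq_iff mult.commute del: vector_sub_rdistrib vector_ssub_ldistrib)
    ultimately have "((\<lambda>t. f (L t)) has_field_derivative (D (y - w))) (at t)"
      by (simp add: has_field_derivative_def)
    then show "(\<lambda>t. f (L t)) field_differentiable at t within S"
      using field_differentiable_at_within field_differentiable_def by blast
  qed
  have "0 \<in> T" "1 \<in> S" using w y by (auto simp: T_def S_def L_def)
  moreover have "T \<subseteq> S" using W by (auto simp: T_def S_def)
  ultimately have "f (L 1) = 0"
    using analytic_continuation_open[OF oT oS _ cS _ hol, of "\<lambda>_. 0" 1] z
    by (auto simp: T_def)
  then show ?thesis by (simp add: L_def)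
qed

lemma mero_atE:
  assumes "mero_at f a"
  obtains r g h where "r > 0" "holo_on g (ball a r)" "holo_on h (ball a r)"
    "nowhere_dense {x\<in>ball a r. h x = 0}"
    "\<forall>x\<in>ball a r. h x \<noteq> 0 \<longrightarrow> f x = g x / h x"
proof -
  obtain U g h where U: "open U" "a \<in> U" "holo_on g U" "holo_on h U"
     "interior {x\<in>U. h x = 0} = {}" "\<forall>x\<in>U. h x \<noteq> 0 \<longrightarrow> f x = g x / h x"
    using assms unfolding mero_at_def by blast
  obtain r where r: "r > 0" "ball a r \<subseteq> U" using U openE by blast
  have "nowhere_dense {x\<in>ball a r. h x = 0}"
    by (rule nowhere_dense_subset[OF nowhere_dense_zeros[OF U(4,1,5)]]) (use r in auto)
  then show ?thesis
    by (intro that[of r g h]) (use r U holo_on_subset in blast)+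
qed

lemma mero_atI:
  assumes "open U" "a \<in> U" "holo_on g U" "holo_on h U" "nowhere_dense {x\<in>U. h x = 0}"
    "\<And>x. x \<in> U \<Longrightarrow> h x \<noteq> 0 \<Longrightarrow> f x = g x / h x"
  shows "mero_at f a"
proof -
  have "interior {x\<in>U. h x = 0} = {}"
    using nowhere_dense_not_open[OF assms(5) open_interior interior_subset] .
  then show ?thesis using assms unfolding mero_at_def by blast
qed

lemma holo_is_mero: "holo_on f UNIV \<Longrightarrow> is_mero f"
  unfolding is_mero_def
  by (intro allI mero_atI[where U = UNIV and g = f and h = "\<lambda>_. 1"]) auto

lemma is_mero_const [simp]: "is_mero (\<lambda>_. c)"
  by (rule holo_is_mero) simp

lemma mero_at_combine:
  assumes "mero_at f a" "mero_at g a"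
  obtains r f1 f2 g1 g2 where "r > 0" "holo_on f1 (ball a r)" "holo_on f2 (ball a r)"
    "holo_on g1 (ball a r)" "holo_on g2 (ball a r)"
    "nowhere_dense {x\<in>ball a r. f2 x * g2 x = 0}"
    "\<forall>x\<in>ball a r. f2 x \<noteq> 0 \<longrightarrow> f x = f1 x / f2 x"
    "\<forall>x\<in>ball a r. g2 x \<noteq> 0 \<longrightarrow> g x = g1 x / g2 x"
proof -
  obtain r f1 f2 where F: "r > 0" "holo_on f1 (ball a r)" "holo_on f2 (ball a r)"
    "nowhere_dense {x\<in>ball a r. f2 x = 0}"
    "\<forall>x\<in>ball a r. f2 x \<noteq> 0 \<longrightarrow> f x = f1 x / f2 x" by (rule mero_atE[OF assms(1)]) (rule that; assumption)
  obtain s g1 g2 where G: "s > 0" "holo_on g1 (ball a s)" "holo_on g2 (ball a s)"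
    "nowhere_dense {x\<in>ball a s. g2 x = 0}"
    "\<forall>x\<in>ball a s. g2 x \<noteq> 0 \<longrightarrow> g x = g1 x / g2 x" by (rule mero_atE[OF assms(2)]) (rule that; assumption)
  define t where "t = min r s"
  have t: "t > 0" "ball a t \<subseteq> ball a r" "ball a t \<subseteq> ball a s"
    using F G by (auto simp: t_def)
  have nd: "nowhere_dense {x\<in>ball a t. f2 x * g2 x = 0}"
    by (rule nowhere_dense_subset[OF nowhere_dense_Un[OF F(4) G(4)]]) (use t in auto)
  show ?thesis
  proof (rule that[of t f1 f2 g1 g2])
    show "\<forall>x\<in>ball a t. f2 x \<noteq> 0 \<longrightarrow> f x = f1 x / f2 x" using F(5) t by blast
    show "\<forall>x\<in>ball a t. g2 x \<noteq> 0 \<longrightarrow> g x = g1 x / g2 x" using G(5) t by blast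
  qed (use t F G nd in \<open>auto intro: holo_on_subset\<close>)
qed

lemma is_mero_add:
  assumes "is_mero f" "is_mero g" shows "is_mero (\<lambda>x. f x + g x)"
  unfolding is_mero_def
proof
  fix a
  have fg: "mero_at f a" "mero_at g a" using assms by (auto simp: is_mero_def)
  obtain r f1 f2 g1 g2 where *: "r > 0" "holo_on f1 (ball a r)" "holo_on f2 (ball a r)"
    "holo_on g1 (ball a r)" "holo_on g2 (ball a r)"
    "nowhere_dense {x\<in>ball a r. f2 x * g2 x = 0}"
    "\<forall>x\<in>ball a r. f2 x \<noteq> 0 \<longrightarrow> f x = f1 x / f2 x"
    "\<forall>x\<in>ball a r. g2 x \<noteq> 0 \<longrightarrow> g x = g1 x / g2 x"
    by (rule mero_at_combine[OF fg]) (rule that; assumption)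
  show "mero_at (\<lambda>x. f x + g x) a"
    by (rule mero_atI[where U = "ball a r" and g = "\<lambda>x. f1 x * g2 x + g1 x * f2 x"
          and h = "\<lambda>x. f2 x * g2 x"])
      (use * in \<open>auto intro!: holo_on_add holo_on_mult simp: field_simps\<close>)
qed

lemma is_mero_mult:
  assumes "is_mero f" "is_mero g" shows "is_mero (\<lambda>x. f x * g x)"
  unfolding is_mero_def
proof
  fix a
  have fg: "mero_at f a" "mero_at g a" using assms by (auto simp: is_mero_def)
  obtain r f1 f2 g1 g2 where *: "r > 0" "holo_on f1 (ball a r)" "holo_on f2 (ball a r)"
    "holo_on g1 (ball a r)" "holo_on g2 (ball a r)"
    "nowhere_dense {x\<in>ball a r. f2 x * g2 x = 0}"
    "\<forall>x\<in>ball a r. f2 x \<noteq> 0 \<longrightarrow> f x = f1 x / f2 x"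
    "\<forall>x\<in>ball a r. g2 x \<noteq> 0 \<longrightarrow> g x = g1 x / g2 x"
    by (rule mero_at_combine[OF fg]) (rule that; assumption)
  show "mero_at (\<lambda>x. f x * g x) a"
    by (rule mero_atI[where U = "ball a r" and g = "\<lambda>x. f1 x * g1 x"
          and h = "\<lambda>x. f2 x * g2 x"])
      (use * in \<open>auto intro!: holo_on_mult\<close>)
qed

lemma is_mero_uminus: "is_mero f \<Longrightarrow> is_mero (\<lambda>x. - f x)"
  using is_mero_mult[of "\<lambda>_. -1" f] by simp

lemma nowhere_dense_shift:
  fixes S :: "'a::real_normed_vector set"
  assumes "nowhere_dense S" shows "nowhere_dense ((\<lambda>x. x + a) -` S)"
proof -
  have "(\<lambda>x. x + a) -` S = (\<lambda>x. - a + x) ` S" by (force simp: image_iff)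
  then show ?thesis
    using assms unfolding nowhere_dense_def
    by (simp only: closure_translation interior_translation) simp
qed

lemma is_mero_shift:
  assumes "is_mero f" shows "is_mero (\<lambda>x. f (x + a))"
  unfolding is_mero_def
proof
  fix b
  have "mero_at f (b + a)" using assms by (simp add: is_mero_def)
  then obtain r g h where *: "r > 0" "holo_on g (ball (b + a) r)" "holo_on h (ball (b + a) r)"
    "nowhere_dense {x\<in>ball (b + a) r. h x = 0}"
    "\<forall>x\<in>ball (b + a) r. h x \<noteq> 0 \<longrightarrow> f x = g x / h x"
    by (rule mero_atE) (rule that; assumption)
  let ?U = "(\<lambda>x. x + a) -` ball (b + a) r"
  show "mero_at (\<lambda>x. f (x + a)) b"
  proof (rule mero_atI[where U = ?U and g = "\<lambda>x. g (x + a)" and h = "\<lambda>x. h (x + a)"])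
    show "open ?U" by (intro open_vimage) (auto intro: continuous_intros)
    show "nowhere_dense {x\<in>?U. h (x + a) = 0}"
      using nowhere_dense_shift[OF *(4), of a] by (simp add: vimage_def)
  qed (use * in \<open>auto intro: holo_on_shift\<close>)
qed

lemma mero_zero_or_nonzero:
  assumes "is_mero f"
  shows "nowhere_dense {x. f x \<noteq> 0} \<or> nowhere_dense {x. f x = 0}"
proof -
  define A where "A = {a. \<exists>V. open V \<and> a \<in> V \<and> nowhere_dense (V \<inter> {x. f x \<noteq> 0})}"
  have "A = \<Union> {V. open V \<and> nowhere_dense (V \<inter> {x. f x \<noteq> 0})}" unfolding A_def by blast
  then have oA: "open A" by auto
  have B: "\<exists>V. open V \<and> a \<in> V \<and> V \<inter> A = {} \<and> nowhere_dense (V \<inter> {x. f x = 0})" if a: "a \<notin> A" for a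
  proof -
    obtain r g h where *: "r > 0" "holo_on g (ball a r)" "holo_on h (ball a r)"
      "nowhere_dense {x\<in>ball a r. h x = 0}"
      "\<forall>x\<in>ball a r. h x \<noteq> 0 \<longrightarrow> f x = g x / h x"
      by (rule mero_atE[OF assms[unfolded is_mero_def, rule_format]]) (rule that; assumption)
    have nW: "W = {}" if W: "open W" "W \<subseteq> ball a r" "\<And>x. x \<in> W \<Longrightarrow> g x = 0" for W
    proof (rule ccontr)
      assume "W \<noteq> {}"
      then have "g y = 0" if "y \<in> ball a r" for y
        using holo_identity[OF *(2) W(1) _ W(2) W(3) that] by blast
      then have "ball a r \<inter> {x. f x \<noteq> 0} \<subseteq> {x\<in>ball a r. h x = 0}" using *(5) by force
      then have "nowhere_dense (ball a r \<inter> {x. f x \<noteq> 0})" using *(4) nowhere_dense_subset by blast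
      then show False using a *(1) unfolding A_def by (metis (mono_tags, lifting) centre_in_ball mem_Collect_eq open_ball)
    qed
    have "interior {x\<in>ball a r. g x = 0} = {}"
      by (rule nW) (use interior_subset in blast)+
    then have g0: "nowhere_dense {x\<in>ball a r. g x = 0}"
      using nowhere_dense_zeros[OF *(2)] by blast
    have "ball a r \<inter> {x. f x = 0} \<subseteq> {x\<in>ball a r. g x = 0} \<union> {x\<in>ball a r. h x = 0}"
      using *(5) by force
    then have nd: "nowhere_dense (ball a r \<inter> {x. f x = 0})"
      using nowhere_dense_subset nowhere_dense_Un g0 *(4) by blast
    have "b \<notin> A" if b: "b \<in> ball a r" for b
    proof
      assume "b \<in> A"
      then obtain V where V: "open V" "b \<in> V" "nowhere_dense (V \<inter> {x. f x \<noteq> 0})"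
        unfolding A_def by blast
      have "V \<inter> ball a r \<subseteq> (V \<inter> {x. f x \<noteq> 0}) \<union> (ball a r \<inter> {x. f x = 0})" by blast
      then have "V \<inter> ball a r = {}"
        by (rule nowhere_dense_not_open[OF nowhere_dense_Un[OF V(3) nd] open_Int[OF V(1) open_ball]])
      then show False using V b by blast
    qed
    then show ?thesis using nd *(1) by (intro exI[of _ "ball a r"]) auto
  qed
  have "\<exists>V. open V \<and> a \<in> V \<and> V \<subseteq> - A" if "a \<in> - A" for a
    using B that by (meson ComplD ComplI disjoint_iff subsetI)
  then have "open (- A)" by (subst open_subopen) blast
  then have "A = {} \<or> A = UNIV"
    using oA clopen[of A] closed_def by blast
  then show ?thesis
  proof
    assume "A = {}"
    then have "nowhere_dense {x. f x = 0}" using B by (intro nowhere_dense_locally) blast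
    then show ?thesis ..
  next
    assume "A = UNIV"
    then have "nowhere_dense {x. f x \<noteq> 0}"
      by (intro nowhere_dense_locally) (auto simp: A_def)
    then show ?thesis ..
  qed
qed

lemma is_mero_inverse:
  assumes "is_mero f" shows "is_mero (\<lambda>x. inverse (f x))"
proof (cases "nowhere_dense {x. f x \<noteq> 0}")
  case True
  show ?thesis unfolding is_mero_def
  proof
    fix a
    obtain r g h where *: "r > 0" "holo_on g (ball a r)" "holo_on h (ball a r)"
      "nowhere_dense {x\<in>ball a r. h x = 0}"
      "\<forall>x\<in>ball a r. h x \<noteq> 0 \<longrightarrow> f x = g x / h x"
      by (rule mero_atE[OF assms[unfolded is_mero_def, rule_format]]) (rule that; assumption)
    have "open {x\<in>ball a r. g x * h x \<noteq> 0}"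
      by (rule open_nonzeros) (use * in \<open>auto intro: holo_on_mult\<close>)
    moreover have "{x\<in>ball a r. g x * h x \<noteq> 0} \<subseteq> {x. f x \<noteq> 0}" using *(5) by auto
    ultimately have "{x\<in>ball a r. g x * h x \<noteq> 0} = {}"
      using True nowhere_dense_not_open by blast
    then have "\<And>x. x \<in> ball a r \<Longrightarrow> h x \<noteq> 0 \<Longrightarrow> f x = 0" using *(5) by auto
    then show "mero_at (\<lambda>x. inverse (f x)) a"
      by (intro mero_atI[where U = "ball a r" and g = "\<lambda>_. 0" and h = h]) (use * in auto)
  qed
next
  case False
  then have Z: "nowhere_dense {x. f x = 0}" using mero_zero_or_nonzero[OF assms] by blast
  show ?thesis unfolding is_mero_def
  proof
    fix a
    obtain r g h where *: "r > 0" "holo_on g (ball a r)" "holo_on h (ball a r)"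
      "nowhere_dense {x\<in>ball a r. h x = 0}"
      "\<forall>x\<in>ball a r. h x \<noteq> 0 \<longrightarrow> f x = g x / h x"
      by (rule mero_atE[OF assms[unfolded is_mero_def, rule_format]]) (rule that; assumption)
    have "{x\<in>ball a r. g x * h x = 0} \<subseteq> {x. f x = 0} \<union> {x\<in>ball a r. h x = 0}"
      using *(5) by auto
    then have "nowhere_dense {x\<in>ball a r. g x * h x = 0}"
      using nowhere_dense_subset nowhere_dense_Un Z *(4) by blast
    then show "mero_at (\<lambda>x. inverse (f x)) a"
      by (intro mero_atI[where U = "ball a r" and g = "\<lambda>x. h x * h x" and h = "\<lambda>x. g x * h x"])
        (use * in \<open>auto intro: holo_on_mult\<close>)
  qed
qed

lemma mero_eq_refl: "is_mero f \<Longrightarrow> mero_eq f f"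
  by (simp add: mero_eq_def)

lemma mero_eqI: "is_mero f \<Longrightarrow> f = g \<Longrightarrow> mero_eq f g"
  by (simp add: mero_eq_def)

lemma mero_eqD: "mero_eq f g \<Longrightarrow> is_mero f" "mero_eq f g \<Longrightarrow> is_mero g"
  by (simp_all add: mero_eq_def)

lemma mero_eq_sym: "mero_eq f g \<Longrightarrow> mero_eq g f"
  by (simp add: mero_eq_def eq_commute)

lemma mero_eq_trans:
  assumes "mero_eq f g" "mero_eq g h" shows "mero_eq f h"
proof -
  have "{x. f x \<noteq> h x} \<subseteq> {x. f x \<noteq> g x} \<union> {x. g x \<noteq> h x}" by auto
  then show ?thesis using assms nowhere_dense_subset nowhere_dense_Un unfolding mero_eq_def by blast
qed

quotient_type (overloaded) 'n mero = "complex^('n::finite) \<Rightarrow> complex" / partial: mero_eq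
proof (rule part_equivpI)
  show "\<exists>x. mero_eq x x" using mero_eq_refl[OF is_mero_const] by blast
  show "symp mero_eq" by (auto intro: sympI mero_eq_sym)
  show "transp mero_eq" by (auto intro: transpI mero_eq_trans)
qed

lemma mero_eq_lift2:
  fixes f f' g g' :: "complex^'n::finite \<Rightarrow> complex"
  assumes "mero_eq f f'" "mero_eq g g'" "\<And>f g :: complex^'n \<Rightarrow> complex. is_mero f \<Longrightarrow> is_mero g \<Longrightarrow> is_mero (\<lambda>x. F (f x) (g x))"
  shows "mero_eq (\<lambda>x. F (f x) (g x)) (\<lambda>x. F (f' x) (g' x))"
proof -
  have "{x. F (f x) (g x) \<noteq> F (f' x) (g' x)} \<subseteq> {x. f x \<noteq> f' x} \<union> {x. g x \<noteq> g' x}" by auto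
  moreover have "nowhere_dense ({x. f x \<noteq> f' x} \<union> {x. g x \<noteq> g' x})"
    using assms(1,2) by (intro nowhere_dense_Un) (simp_all add: mero_eq_def)
  ultimately have "nowhere_dense {x. F (f x) (g x) \<noteq> F (f' x) (g' x)}"
    by (rule nowhere_dense_subset[rotated])
  then show ?thesis
    using assms(3)[OF mero_eqD(1)[OF assms(1)] mero_eqD(1)[OF assms(2)]]
      assms(3)[OF mero_eqD(2)[OF assms(1)] mero_eqD(2)[OF assms(2)]]
    by (simp add: mero_eq_def)
qed

lemma mero_eq_lift1:
  fixes f f' :: "complex^'n::finite \<Rightarrow> complex"
  assumes "mero_eq f f'" "\<And>f :: complex^'n \<Rightarrow> complex. is_mero f \<Longrightarrow> is_mero (\<lambda>x. F (f x))"
  shows "mero_eq (\<lambda>x. F (f x)) (\<lambda>x. F (f' x))"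
  by (rule mero_eq_lift2[OF assms(1) assms(1), of "\<lambda>a _. F a"]) (rule assms(2))

lemma is_mero_diff: "is_mero f \<Longrightarrow> is_mero g \<Longrightarrow> is_mero (\<lambda>x. f x - g x)"
  using is_mero_add[OF _ is_mero_uminus, of f g] by simp

lemma is_mero_divide: "is_mero f \<Longrightarrow> is_mero g \<Longrightarrow> is_mero (\<lambda>x. f x / g x)"
  using is_mero_mult[OF _ is_mero_inverse, of f g] by (simp add: divide_inverse)

instantiation mero :: (finite) field
begin

lift_definition zero_mero :: "'a mero" is "\<lambda>_. 0" by (simp add: mero_eq_refl)
lift_definition one_mero :: "'a mero" is "\<lambda>_. 1" by (simp add: mero_eq_refl)
lift_definition plus_mero :: "'a mero \<Rightarrow> 'a mero \<Rightarrow> 'a mero" is "\<lambda>f g x. f x + g x"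
  by (rule mero_eq_lift2[where F = "(+)"]) (simp_all add: is_mero_add)
lift_definition minus_mero :: "'a mero \<Rightarrow> 'a mero \<Rightarrow> 'a mero" is "\<lambda>f g x. f x - g x"
  by (rule mero_eq_lift2[where F = "(-)"]) (simp_all add: is_mero_diff)
lift_definition times_mero :: "'a mero \<Rightarrow> 'a mero \<Rightarrow> 'a mero" is "\<lambda>f g x. f x * g x"
  by (rule mero_eq_lift2[where F = "(*)"]) (simp_all add: is_mero_mult)
lift_definition divide_mero :: "'a mero \<Rightarrow> 'a mero \<Rightarrow> 'a mero" is "\<lambda>f g x. f x / g x"
  by (rule mero_eq_lift2[where F = "(/)"]) (simp_all add: is_mero_divide)
lift_definition uminus_mero :: "'a mero \<Rightarrow> 'a mero" is "\<lambda>f x. - f x"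
  by (rule mero_eq_lift1[where F = uminus]) (simp_all add: is_mero_uminus)
lift_definition inverse_mero :: "'a mero \<Rightarrow> 'a mero" is "\<lambda>f x. inverse (f x)"
  by (rule mero_eq_lift1[where F = inverse]) (simp_all add: is_mero_inverse)

instance
proof
  fix a b c :: "'a mero"
  note i = is_mero_add is_mero_mult is_mero_diff is_mero_uminus is_mero_divide is_mero_inverse
  show "a + b + c = a + (b + c)"
    by transfer (auto intro!: mero_eqI i simp: fun_eq_iff dest: mero_eqD)
  show "a + b = b + a"
    by transfer (auto intro!: mero_eqI i simp: fun_eq_iff dest: mero_eqD)
  show "0 + a = a"
    by transfer (auto intro!: mero_eqI i simp: fun_eq_iff dest: mero_eqD)
  show "- a + a = 0"
    by transfer (auto intro!: mero_eqI i simp: fun_eq_iff dest: mero_eqD)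
  show "a - b = a + - b"
    by transfer (auto intro!: mero_eqI i simp: fun_eq_iff dest: mero_eqD)
  show "a * b * c = a * (b * c)"
    by transfer (auto intro!: mero_eqI i simp: fun_eq_iff dest: mero_eqD)
  show "a * b = b * a"
    by transfer (auto intro!: mero_eqI i simp: fun_eq_iff dest: mero_eqD)
  show "1 * a = a"
    by transfer (auto intro!: mero_eqI i simp: fun_eq_iff dest: mero_eqD)
  show "(a + b) * c = a * c + b * c"
    by transfer (auto intro!: mero_eqI i simp: fun_eq_iff algebra_simps dest: mero_eqD)
  show "a div b = a * inverse b"
    by transfer (auto intro!: mero_eqI i simp: fun_eq_iff divide_inverse dest: mero_eqD)
  show "inverse (0::'a mero) = 0"
    by transfer (auto intro!: mero_eqI)
  show "(0::'a mero) \<noteq> 1"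
    by transfer (auto simp: mero_eq_def nowhere_dense_def)
  show "a \<noteq> 0 \<Longrightarrow> inverse a * a = 1"
  proof transfer
    fix f :: "complex^'a \<Rightarrow> complex"
    assume f: "mero_eq f f" and n: "\<not> mero_eq f (\<lambda>_. 0)"
    have m: "is_mero f" using f mero_eqD by blast
    have "nowhere_dense {x. f x = 0}"
      using n m mero_zero_or_nonzero[OF m] unfolding mero_eq_def by simp
    moreover have "{x. inverse (f x) * f x \<noteq> 1} \<subseteq> {x. f x = 0}"
      using left_inverse by blast
    ultimately show "mero_eq (\<lambda>x. inverse (f x) * f x) (\<lambda>_. 1)"
      unfolding mero_eq_def using nowhere_dense_subset m by (auto intro: i)
  qed
qed

end

lift_definition mero_const :: "complex \<Rightarrow> 'n::finite mero" is "\<lambda>c _. c"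
  by (simp add: mero_eq_refl)

lift_definition mero_shift :: "complex^'n::finite \<Rightarrow> 'n mero \<Rightarrow> 'n mero"
  is "\<lambda>a f P. f (P + a)"
proof -
  fix a and f g :: "complex^'n \<Rightarrow> complex"
  assume "mero_eq f g"
  then show "mero_eq (\<lambda>P. f (P + a)) (\<lambda>P. g (P + a))"
    unfolding mero_eq_def using nowhere_dense_shift[of "{x. f x \<noteq> g x}" a]
    by (auto intro: is_mero_shift simp: vimage_def)
qed


section \<open>Theta functions\<close>

definition qpoch_inf :: "complex \<Rightarrow> complex \<Rightarrow> complex" where
  "qpoch_inf x p = (\<Prod>n. 1 - x * p ^ n)"

definition Theta :: "complex \<Rightarrow> complex \<Rightarrow> complex" where
  "Theta p z = qpoch_inf z p * qpoch_inf (p / z) p * qpoch_inf p p"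

text \<open>
  The function \<open>\<theta>(z) = - z\<^sup>-\<^sup>1\<^sup>/\<^sup>2 \<Theta>\<^sub>p(z)\<close> is two-valued in \<open>z\<close>. It is therefore
  parametrised by a logarithm of its argument: \<open>theta p x\<close> is \<open>\<theta>(e\<^sup>x)\<close> with the branch
  \<open>z\<^sup>1\<^sup>/\<^sup>2 = e\<^sup>x\<^sup>/\<^sup>2\<close>, which is an entire function of \<open>x\<close>. Accordingly, \<open>q\<close>, the evaluation
  parameters \<open>w\<^sub>i\<close>, the spectral parameter \<open>z\<close> and \<open>\<Pi>\<^sup>*\<close> are all represented below by
  logarithms, and multiplicative arguments of \<open>\<theta>\<close> turn into sums.
\<close>

definition theta :: "complex \<Rightarrow> complex \<Rightarrow> complex" where
  "theta p x = - exp (- x / 2) * Theta p (exp x)"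

section \<open>The tensor product of vector representations\<close>

text \<open>
  The multi-indices \<open>\<mu> \<in> [1,N]\<^sup>n\<close>. Vectors are families of coefficients with respect to the basis
  \<open>v\<^sub>\<mu>\<close>; they vanish outside \<open>multi_index N n\<close>.
\<close>

definition multi_index :: "nat \<Rightarrow> nat \<Rightarrow> (nat \<Rightarrow> nat) set" where
  "multi_index N n = {1..n} \<rightarrow>\<^sub>E {1..N}"

type_synonym 'n vec_rep = "(nat \<Rightarrow> nat) \<Rightarrow> 'n mero"

definition vscale :: "'n::finite mero \<Rightarrow> 'n vec_rep \<Rightarrow> 'n vec_rep" where
  "vscale c v = (\<lambda>\<mu>. c * v \<mu>)"

definition comp_list :: "('a \<Rightarrow> 'a) list \<Rightarrow> 'a \<Rightarrow> 'a" where
  "comp_list Fs = foldr (\<circ>) Fs id"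

text \<open>The \<open>a\<close>-th smallest element of a finite set, counted from 1.\<close>

definition nth_elem :: "nat set \<Rightarrow> nat \<Rightarrow> nat" where
  "nth_elem S a = sorted_list_of_set S ! (a - 1)"

definition matrix_unit :: "nat \<Rightarrow> nat \<Rightarrow> nat \<Rightarrow> nat \<Rightarrow> 'n::finite mero" where
  "matrix_unit i j a b = (if a = i \<and> b = j then 1 else 0)"

definition ordered_partitions :: "nat \<Rightarrow> nat \<Rightarrow> (nat \<Rightarrow> nat set) set" where
  "ordered_partitions N n =
     {I. (\<Union>k\<in>{1..N}. I k) = {1..n} \<and> disjoint_family_on I {1..N}}"

definition tail_union :: "nat \<Rightarrow> (nat \<Rightarrow> nat set) \<Rightarrow> nat \<Rightarrow> nat set" where
  "tail_union N I l = (\<Union>k\<in>{l+1..N}. I k)"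

text \<open>
  The rank \<open>N\<close> is \<open>CARD('n)\<close>. The dynamical variables are the coordinates on \<open>complex^'n\<close>,
  enumerated by \<open>idx\<close>: \<open>P $ idx j\<close> is \<open>P\<^sub>\<epsilon>\<^sub>j\<close> for \<open>j \<in> {1..N}\<close>. All indices of matrices and
  vectors are natural numbers in \<open>{1..N}\<close>.
\<close>

context
  fixes idx :: "nat \<Rightarrow> 'n::finite" and p logq :: complex
begin

text \<open>Logarithm of \<open>\<Pi>\<^sup>*\<^sub>j\<^sub>,\<^sub>k q\<^sup>2\<^sup>(\<^sup>m\<^sub>j\<^sup>-\<^sup>m\<^sub>k\<^sup>)\<close>.\<close>

definition logPi :: "(nat \<Rightarrow> int) \<Rightarrow> nat \<Rightarrow> nat \<Rightarrow> complex^'n \<Rightarrow> complex" where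
  "logPi m j k P = 2 * logq * (P $ idx j - P $ idx k + of_int (m j - m k))"

definition mero_theta :: "(complex^'n \<Rightarrow> complex) \<Rightarrow> 'n mero" where
  "mero_theta f = abs_mero (\<lambda>P. theta p (f P))"

definition const_theta :: "complex \<Rightarrow> 'n mero" where
  "const_theta x = mero_const (theta p x)"

text \<open>
  \<open>Rmat x m c d \<beta> \<alpha>\<close> is the coefficient of \<open>E\<^sub>c\<^sub>d \<otimes> E\<^sub>\<beta>\<^sub>\<alpha>\<close> in the dynamical R-matrix at
  \<open>z = e\<^sup>x\<close> and at the dynamical parameters \<open>\<Pi>\<^sup>*\<^sub>j\<^sub>,\<^sub>k q\<^sup>2\<^sup>(\<^sup>m\<^sub>j\<^sup>-\<^sup>m\<^sub>k\<^sup>)\<close>.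
\<close>

definition Rmat :: "complex \<Rightarrow> (nat \<Rightarrow> int) \<Rightarrow> nat \<Rightarrow> nat \<Rightarrow> nat \<Rightarrow> nat \<Rightarrow> 'n mero" where
  "Rmat x m c d \<beta> \<alpha> =
     (\<Sum>j=1..CARD('n). const_theta (2 * logq + x) * (matrix_unit j j c d * matrix_unit j j \<beta> \<alpha>))
   + (\<Sum>k=1..CARD('n). \<Sum>j=1..<k.
        mero_theta (\<lambda>P. 2 * logq + logPi m j k P) * mero_theta (\<lambda>P. - 2 * logq + logPi m j k P)
          * const_theta x / (mero_theta (logPi m j k))\<^sup>2
          * (matrix_unit j j c d * matrix_unit k k \<beta> \<alpha>)
      + const_theta x * (matrix_unit k k c d * matrix_unit j j \<beta> \<alpha>)
      + const_theta (2 * logq) * mero_theta (\<lambda>P. x + logPi m j k P) / mero_theta (logPi m j k)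
          * (matrix_unit j k c d * matrix_unit k j \<beta> \<alpha>)
      + const_theta (2 * logq) * mero_theta (\<lambda>P. x - logPi m j k P)
          / mero_theta (\<lambda>P. - logPi m j k P)
          * (matrix_unit k j c d * matrix_unit j k \<beta> \<alpha>))"

context
  fixes n :: nat and logw :: "nat \<Rightarrow> complex"
begin

text \<open>
  Matrix entry from \<open>e\<^sub>d \<otimes> v\<^sub>\<gamma>\<close> to \<open>e\<^sub>c \<otimes> v\<^sub>\<beta>\<close> of the R-matrix
  \<open>R\<^sup>(\<^sup>0\<^sup>i\<^sup>)(z/w\<^sub>i, \<Pi>\<^sup>* q\<^bsup>2(h\<^sup>(\<^sup>1\<^sup>) + \<dots> + h\<^sup>(\<^sup>i\<^sup>-\<^sup>1\<^sup>))\<^esup>)\<close> acting on the auxiliary space and the \<open>i\<close>-th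
  tensor factor; on \<open>v\<^sub>\<gamma>\<close> the dynamical parameters are shifted by
  \<open>m\<^sub>j = #{a < i. \<gamma>\<^sub>a = j}\<close>.
\<close>

definition R_aux ::
    "complex \<Rightarrow> nat \<Rightarrow> nat \<Rightarrow> (nat \<Rightarrow> nat) \<Rightarrow> nat \<Rightarrow> (nat \<Rightarrow> nat) \<Rightarrow> 'n mero" where
  "R_aux x i c \<beta> d \<gamma> =
     (if \<forall>a\<in>{1..n} - {i}. \<beta> a = \<gamma> a
      then Rmat (x - logw i) (\<lambda>j. int (card {a\<in>{1..<i}. \<gamma> a = j})) c d (\<beta> i) (\<gamma> i)
      else 0)"

text \<open>Matrix entries of the product \<open>R\<^sup>(\<^sup>0\<^sup>i\<^sup>) \<cdots> R\<^sup>(\<^sup>0\<^sup>2\<^sup>) R\<^sup>(\<^sup>0\<^sup>1\<^sup>)\<close>.\<close>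

primrec R_prod ::
    "complex \<Rightarrow> nat \<Rightarrow> nat \<Rightarrow> (nat \<Rightarrow> nat) \<Rightarrow> nat \<Rightarrow> (nat \<Rightarrow> nat) \<Rightarrow> 'n mero" where
  "R_prod x 0 c \<beta> d \<gamma> = (if c = d \<and> \<beta> = \<gamma> then 1 else 0)"
| "R_prod x (Suc i) c \<beta> d \<gamma> =
     (\<Sum>e=1..CARD('n). \<Sum>\<delta>\<in>multi_index CARD('n) n.
        R_aux x (Suc i) c \<beta> e \<delta> * R_prod x i e \<delta> d \<gamma>)"

text \<open>Coefficient of \<open>v\<^sub>\<beta>\<close> in \<open>T\<^sub>k\<^sub>l(z; \<Pi>\<^sup>*) v\<^sub>\<alpha>\<close>, where \<open>z = e\<^sup>x\<close>.\<close>

definition T_op :: "nat \<Rightarrow> nat \<Rightarrow> complex \<Rightarrow> (nat \<Rightarrow> nat) \<Rightarrow> (nat \<Rightarrow> nat) \<Rightarrow> 'n mero" where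
  "T_op k l x \<beta> \<alpha> = R_prod x n k \<beta> l \<alpha>"

definition L_op :: "nat \<Rightarrow> nat \<Rightarrow> complex \<Rightarrow> 'n vec_rep \<Rightarrow> 'n vec_rep" where
  "L_op k l x v = (\<lambda>\<beta>. if \<beta> \<in> multi_index CARD('n) n
     then \<Sum>\<alpha>\<in>multi_index CARD('n) n. mero_shift (axis (idx l) 1) (v \<alpha>) * T_op k l x \<beta> \<alpha>
     else 0)"

definition highest_vec :: "'n vec_rep" where
  "highest_vec = (\<lambda>\<mu>. if \<mu> = (\<lambda>a\<in>{1..n}. 1) then 1 else 0)"

definition dyn_sgn :: "nat set \<Rightarrow> (nat \<Rightarrow> nat) \<Rightarrow> 'n mero" where
  "dyn_sgn J \<sigma> =
     (\<Prod>(a, b)\<in>{(a, b). a \<in> {1..card J} \<and> b \<in> {1..card J} \<and> a < b \<and> \<sigma> a > \<sigma> b}.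
        mero_theta (\<lambda>P. 2 * logq + logPi (\<lambda>_. 0) (nth_elem J (\<sigma> a)) (nth_elem J (\<sigma> b)) P)
      / mero_theta (logPi (\<lambda>_. 0) (nth_elem J (\<sigma> b)) (nth_elem J (\<sigma> a))))"

text \<open>The quantum minor with row set \<open>R\<close> and column set \<open>J\<close> of equal cardinality, at \<open>z = e\<^sup>x\<close>.\<close>

definition quantum_minor :: "nat set \<Rightarrow> nat set \<Rightarrow> complex \<Rightarrow> 'n vec_rep \<Rightarrow> 'n vec_rep" where
  "quantum_minor R J x v = (\<lambda>\<mu>. \<Sum>\<sigma> | \<sigma> permutes {1..card J}. dyn_sgn J \<sigma> *
     comp_list (map (\<lambda>a. L_op (nth_elem R a) (nth_elem J (\<sigma> a)) (x - 2 * of_nat (a - 1) * logq))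
       [1..<card J + 1]) v \<mu>)"

text \<open>\<open>X(w\<^sub>S) = X(w\<^sub>s\<^sub>r) \<cdots> X(w\<^sub>s\<^sub>1)\<close> for \<open>S = {s\<^sub>1 < \<cdots> < s\<^sub>r}\<close>.\<close>

definition at_w :: "(complex \<Rightarrow> 'n vec_rep \<Rightarrow> 'n vec_rep) \<Rightarrow> nat set \<Rightarrow> 'n vec_rep \<Rightarrow> 'n vec_rep" where
  "at_w X S = comp_list (map (\<lambda>s. X (logw s)) (rev (sorted_list_of_set S)))"

definition xi :: "(nat \<Rightarrow> nat set) \<Rightarrow> 'n vec_rep" where
  "xi I = comp_list
     (map (\<lambda>l. at_w (quantum_minor ({l} \<union> {l+2..CARD('n)}) {l+1..CARD('n)})
                 (tail_union CARD('n) I l))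
       (rev [1..<CARD('n)])) highest_vec"

definition xi_tilde :: "(nat \<Rightarrow> nat set) \<Rightarrow> 'n vec_rep" where
  "xi_tilde I = comp_list
     (map (\<lambda>l. at_w (L_op l (l + 1)) (tail_union CARD('n) I l)) (rev [1..<CARD('n)])) highest_vec"

end

end

end

theory Submission
  imports Defs
begin

text \<open>
  The idea is that the minor with rows \<open>{l, l+2, \<dots>, N}\<close> and columns \<open>{l+1, \<dots>, N}\<close> acts on a vector in
  which the basis indices \<open>l+2, \<dots>, N\<close> do not yet occur, and that on such vectors it degenerates to a
  constant times \<open>L\<^sub>l\<^sub>,\<^sub>l\<^sub>+\<^sub>1\<close>.

  The R-matrix keeps or exchanges the auxiliary and the quantum index. If all indices of a basis vector
  are at most \<open>m\<close> and \<open>k > m\<close>, then \<open>T\<^sub>k\<^sub>d\<close> can only end with the auxiliary index \<open>k\<close> if it starts with it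
  and never exchanges it; so \<open>T\<^sub>k\<^sub>d\<close> vanishes for \<open>d \<noteq> k\<close>, and \<open>T\<^sub>k\<^sub>k(z)\<close> is multiplication by
  \<open>\<Prod>\<^sub>j \<theta>(z / w\<^sub>j)\<close> (lemma \<open>R_prod_above\<close>). The operator \<open>L\<^sub>k\<^sub>k\<close> also shifts \<open>P\<^sub>k\<close>, but the coefficients of the
  vectors in question do not involve \<open>P\<^sub>k\<close> (lemma \<open>R_prod_below\<close>). The space \<open>sector idx n m\<close> collects
  the vectors with these two properties.

  On \<open>sector idx n (l + 1)\<close>, the rows \<open>N, N-1, \<dots>, l+2\<close> of the minor, in this order, therefore force the
  columns \<open>N, N-1, \<dots>, l+2\<close>. All permutations but the identity drop out, and the row \<open>l + a + 1\<close>, taken at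
  \<open>q\<^sup>-\<^sup>2\<^sup>a z\<close>, contributes \<open>\<Prod>\<^sub>j \<theta>(q\<^sup>-\<^sup>2\<^sup>a z / w\<^sub>j)\<close> (lemma \<open>quantum_minor_on_sector\<close>). The remaining operator
  \<open>L\<^sub>l\<^sub>,\<^sub>l\<^sub>+\<^sub>1\<close> preserves \<open>sector idx n (l + 1)\<close>, so the argument applies to each of the values \<open>z = w\<^sub>s\<close>, and
  then to \<open>l + 1\<close> in place of \<open>l\<close>. It starts from \<open>\<zeta>\<close>, whose indices are all \<open>1\<close>. The constants commute
  with all \<open>L\<close>-operators and combine to the factor in the theorem.
\<close>

section \<open>Theta functions of holomorphic functions\<close>

lemma qpoch_inf_entire:
  assumes "norm p < 1"
  shows "(\<lambda>x. qpoch_inf x p) holomorphic_on UNIV"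
proof (rule holomorphic_uniform_sequence)
  show "(\<lambda>x. \<Prod>n<k. 1 - x * p ^ n) holomorphic_on UNIV" for k
    by (intro holomorphic_intros)
  fix x :: complex
  let ?A = "cball x 1"
  have "uniformly_convergent_on ?A (\<lambda>k x. \<Sum>n<k. norm ((1 - x * p ^ n) - 1))"
  proof (rule Weierstrass_m_test')
    show "norm (norm ((1 - y * p ^ n) - 1)) \<le> (norm x + 1) * norm p ^ n" if "y \<in> ?A" for n y
    proof -
      have "norm y \<le> norm x + 1"
        using that norm_triangle_ineq4[of x "x - y"] by (simp add: dist_norm)
      then show ?thesis
        by (simp add: norm_mult norm_power mult_right_mono)
    qed
    show "summable (\<lambda>n. (norm x + 1) * norm p ^ n)"
      using assms by (intro summable_mult summable_geometric) simp
  qed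
  then have "uniformly_convergent_on ?A (\<lambda>k x. \<Prod>n<k. 1 - x * p ^ n)"
    by (intro uniformly_convergent_on_prod') (auto intro!: continuous_intros)
  then obtain g where g: "uniform_limit ?A (\<lambda>k x. \<Prod>n<k. 1 - x * p ^ n) g sequentially"
    unfolding uniformly_convergent_on_def by blast
  have g_eq: "g y = qpoch_inf y p" if "y \<in> ?A" for y
  proof -
    have "summable (\<lambda>n. norm y * norm p ^ n)"
      using assms by (intro summable_mult summable_geometric) simp
    then have "abs_convergent_prod (\<lambda>n. 1 - y * p ^ n)"
      by (intro summable_imp_abs_convergent_prod) (simp add: norm_mult norm_power)
    then have "(\<lambda>k. \<Prod>n\<le>k. 1 - y * p ^ n) \<longlonglongrightarrow> qpoch_inf y p"
      unfolding qpoch_inf_def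
      by (intro convergent_prod_LIMSEQ abs_convergent_prod_imp_convergent_prod)
    then have "(\<lambda>k. \<Prod>n<k. 1 - y * p ^ n) \<longlonglongrightarrow> qpoch_inf y p"
      unfolding lessThan_Suc_atMost[symmetric] by (rule LIMSEQ_imp_Suc)
    with tendsto_uniform_limitI[OF g that] show ?thesis
      using LIMSEQ_unique by blast
  qed
  have "uniform_limit ?A (\<lambda>k x. \<Prod>n<k. 1 - x * p ^ n) g sequentially \<longleftrightarrow>
      uniform_limit ?A (\<lambda>k x. \<Prod>n<k. 1 - x * p ^ n) (\<lambda>x. qpoch_inf x p) sequentially"
    by (rule uniform_limit_cong') (simp_all only: g_eq)
  with g show "\<exists>d. 0 < d \<and> cball x d \<subseteq> UNIV \<and>
      uniform_limit (cball x d) (\<lambda>k x. \<Prod>n<k. 1 - x * p ^ n) (\<lambda>x. qpoch_inf x p) sequentially"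
    by (intro exI[of _ 1] conjI subset_UNIV zero_less_one) (simp only:)
qed (rule open_UNIV)

text \<open>
  Since the argument of \<open>theta\<close> is logarithmic, both \<open>z = e\<^sup>x\<close> and \<open>p / z\<close> are entire in \<open>x\<close>, so
  neither the pole of \<open>p / z\<close> at \<open>0\<close> nor the branch of \<open>z\<^sup>1\<^sup>/\<^sup>2\<close> is seen.
\<close>

lemma theta_entire:
  assumes "norm p < 1"
  shows "theta p holomorphic_on UNIV"
proof -
  have q: "(\<lambda>x. qpoch_inf (f x) p) holomorphic_on UNIV" if "f holomorphic_on UNIV" for f
    using holomorphic_on_compose_gen[OF that qpoch_inf_entire[OF assms]] by (simp add: o_def)
  show ?thesis
    unfolding theta_def Theta_def by (intro holomorphic_intros q) auto
qed

lemma holo_on_compose_entire: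
  fixes f :: "complex^'n::finite \<Rightarrow> complex"
  assumes "g holomorphic_on UNIV" "holo_on f U"
  shows "holo_on (\<lambda>P. g (f P)) U"
  unfolding holo_on_def
proof
  fix P assume "P \<in> U"
  then obtain D where D: "(f has_derivative D) (at P)" "\<forall>c v. D (c *s v) = c * D v"
    using assms(2) unfolding holo_on_def by meson
  obtain g' where "(g has_field_derivative g') (at (f P))"
    using holomorphic_on_imp_differentiable_at[OF assms(1) open_UNIV UNIV_I]
    unfolding field_differentiable_def by blast
  then have "(g has_derivative (*) g') (at (f P))"
    by (simp add: has_field_derivative_def)
  from has_derivative_compose[OF D(1) this]
  show "\<exists>D. ((\<lambda>P. g (f P)) has_derivative D) (at P) \<and> (\<forall>c v. D (c *s v) = c * D v)"
    using D(2) by (intro exI[of _ "\<lambda>v. g' * D v"]) (simp add: mult.left_commute)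
qed

lemma holo_on_coordinate: "holo_on (\<lambda>P :: complex^'n::finite. P $ i) U"
  unfolding holo_on_def
proof
  fix P :: "complex^'n"
  have "((\<lambda>P. P $ i) has_derivative (\<lambda>P. P $ i)) (at P)"
    by (intro bounded_linear.has_derivative[OF bounded_linear_vec_nth] has_derivative_ident)
  then show "\<exists>D. ((\<lambda>P. P $ i) has_derivative D) (at P) \<and> (\<forall>c v. D (c *s v) = c * D v)"
    by (intro exI[of _ "\<lambda>v. v $ i"]) simp
qed

lemma holo_on_diff:
  assumes "holo_on f U" "holo_on g U" shows "holo_on (\<lambda>x. f x - g x) U"
  using holo_on_add[OF assms(1) holo_on_mult[OF holo_on_const[of "- 1"] assms(2)]] by simp

lemma holo_on_logPi: "holo_on (logPi idx logq m j k) U"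
  unfolding logPi_def
  by (intro holo_on_add holo_on_diff holo_on_mult holo_on_const holo_on_coordinate)

section \<open>Shifts of the dynamical variables\<close>

lemma mero_shift_mult: "mero_shift a (x * y) = mero_shift a x * mero_shift a y"
  by transfer (auto intro!: mero_eqI is_mero_shift is_mero_mult simp: fun_eq_iff dest: mero_eqD)

lemma mero_shift_add: "mero_shift a (x + y) = mero_shift a x + mero_shift a y"
  by transfer (auto intro!: mero_eqI is_mero_shift is_mero_add simp: fun_eq_iff dest: mero_eqD)

lemma mero_shift_divide: "mero_shift a (x / y) = mero_shift a x / mero_shift a y"
  by transfer (auto intro!: mero_eqI is_mero_shift is_mero_divide simp: fun_eq_iff dest: mero_eqD)

lemma mero_shift_const: "mero_shift a (mero_const c) = mero_const c"
  by transfer (simp add: mero_eq_refl)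

lemma mero_const_0: "mero_const 0 = 0"
  by transfer (simp add: mero_eq_refl)

lemma mero_const_1: "mero_const 1 = 1"
  by transfer (simp add: mero_eq_refl)

lemma mero_const_mult: "mero_const (a * b) = mero_const a * mero_const b"
  by transfer (simp add: mero_eq_refl)

lemma mero_const_prod: "mero_const (prod f A) = (\<Prod>x\<in>A. mero_const (f x))"
  by (induction A rule: infinite_finite_induct) (simp_all add: mero_const_1 mero_const_mult)

lemma mero_shift_0: "mero_shift a 0 = 0"
  using mero_shift_const[of a 0] by (simp add: mero_const_0)

lemma mero_shift_1: "mero_shift a 1 = 1"
  using mero_shift_const[of a 1] by (simp add: mero_const_1)

lemma mero_shift_sum:
  "mero_shift a (sum f A) = (\<Sum>x\<in>A. mero_shift a (f x))"
  by (induction A rule: infinite_finite_induct) (simp_all add: mero_shift_0 mero_shift_add)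

text \<open>
  Applied to a function that is not meromorphic, \<open>abs_mero\<close> returns an arbitrary element of the
  field, about whose shifts nothing can be said. The analyticity of \<open>theta\<close> rules this out.
\<close>

lemma mero_shift_mero_theta:
  assumes "norm p < 1" "holo_on f UNIV"
  shows "mero_shift a (mero_theta p f) = mero_theta p (\<lambda>P. f (P + a))"
proof -
  have "is_mero (\<lambda>P. theta p (f P))"
    by (rule holo_is_mero[OF holo_on_compose_entire[OF theta_entire[OF assms(1)] assms(2)]])
  then show ?thesis
    unfolding mero_theta_def by (simp add: mero_shift.abs_eq mero_eq_refl)
qed

lemma mero_shift_commute: "mero_shift a (mero_shift b f) = mero_shift b (mero_shift a f)"
proof (transfer, intro mero_eqI)
  fix a b and f :: "complex^'a \<Rightarrow> complex"
  assume "mero_eq f f"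
  then show "is_mero (\<lambda>P. f (P + a + b))"
    using is_mero_shift[OF is_mero_shift[of f b], of a] by (simp add: mero_eq_def)
qed (simp add: add_ac)

text \<open>
  Dependence on \<open>P\<^sub>1, \<dots>, P\<^sub>m\<close> only, in the weak form of invariance under the unit shifts of the other
  variables: unit shifts are the only ones that the \<open>L\<close>-operators perform.
\<close>

definition depends_upto :: "(nat \<Rightarrow> 'n::finite) \<Rightarrow> nat \<Rightarrow> 'n mero \<Rightarrow> bool" where
  "depends_upto idx m f \<longleftrightarrow> (\<forall>k\<in>{m<..CARD('n)}. mero_shift (axis (idx k) 1) f = f)"

named_theorems depends_intros

lemma depends_upto_0 [depends_intros]: "depends_upto idx m 0"
  and depends_upto_1 [depends_intros]: "depends_upto idx m 1"
  and depends_upto_const [depends_intros]: "depends_upto idx m (mero_const c)"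
  and depends_upto_const_theta [depends_intros]: "depends_upto idx m (const_theta p x)"
  by (simp_all add: depends_upto_def const_theta_def mero_shift_0 mero_shift_1 mero_shift_const)

lemma depends_upto_add [depends_intros]:
  "depends_upto idx m f \<Longrightarrow> depends_upto idx m g \<Longrightarrow> depends_upto idx m (f + g)"
  by (simp add: depends_upto_def mero_shift_add)

lemma depends_upto_mult [depends_intros]:
  "depends_upto idx m f \<Longrightarrow> depends_upto idx m g \<Longrightarrow> depends_upto idx m (f * g)"
  by (simp add: depends_upto_def mero_shift_mult)

lemma depends_upto_divide [depends_intros]:
  "depends_upto idx m f \<Longrightarrow> depends_upto idx m g \<Longrightarrow> depends_upto idx m (f / g)"
  by (simp add: depends_upto_def mero_shift_divide)

lemma depends_upto_power2 [depends_intros]: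
  "depends_upto idx m f \<Longrightarrow> depends_upto idx m (f\<^sup>2)"
  by (simp add: power2_eq_square depends_intros)

lemma depends_upto_sum [depends_intros]:
  "(\<And>x. x \<in> A \<Longrightarrow> depends_upto idx m (f x)) \<Longrightarrow> depends_upto idx m (sum f A)"
  by (simp add: depends_upto_def mero_shift_sum)

lemma depends_upto_shift:
  "depends_upto idx m f \<Longrightarrow> depends_upto idx m (mero_shift a f)"
  unfolding depends_upto_def using mero_shift_commute by metis

lemma depends_upto_mono: "depends_upto idx m f \<Longrightarrow> m \<le> m' \<Longrightarrow> depends_upto idx m' f"
  by (simp add: depends_upto_def)

text \<open>
  In a summand of the R-matrix, the dynamical variables in the coefficient are those named by the
  matrix units, so a bound on the incoming indices \<open>d\<close> and \<open>\<alpha>\<close> bounds them too, unless the summand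
  vanishes.
\<close>

lemma depends_upto_matrix_unit:
  assumes "d = j \<Longrightarrow> \<alpha> = l \<Longrightarrow> depends_upto idx m f"
  shows "depends_upto idx m (f * (matrix_unit i j c d * matrix_unit k l \<beta> \<alpha>))"
  using assms by (auto simp: matrix_unit_def intro: depends_intros)

section \<open>Matrix entries of the product of R-matrices\<close>

text \<open>
  The ice rule: each matrix unit in the R-matrix keeps or exchanges the auxiliary and the quantum index.
\<close>

lemma Rmat_eq_0:
  assumes "\<not> (c = d \<and> \<beta> = \<alpha>)" "\<not> (c = \<alpha> \<and> \<beta> = d)"
  shows "Rmat idx p logq x m c d \<beta> \<alpha> = 0"
proof -
  have 1: "matrix_unit i i c d * matrix_unit j j \<beta> \<alpha> = (0 :: 'a mero)" for i j
    using assms by (auto simp: matrix_unit_def)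
  have 2: "matrix_unit i j c d * matrix_unit j i \<beta> \<alpha> = (0 :: 'a mero)" for i j
    using assms by (auto simp: matrix_unit_def)
  show ?thesis
    unfolding Rmat_def 1 2 by simp
qed

text \<open>
  The R-matrix is not symmetric under the flip: the coefficient of \<open>E\<^sub>j\<^sub>j \<otimes> E\<^sub>k\<^sub>k\<close> is dynamical for
  \<open>j < k\<close>, that of \<open>E\<^sub>k\<^sub>k \<otimes> E\<^sub>j\<^sub>j\<close> is a constant.
\<close>

lemma Rmat_diagonal_gt:
  fixes idx :: "nat \<Rightarrow> 'n::finite"
  assumes "1 \<le> j" "j < k" "k \<le> CARD('n)"
  shows "Rmat idx p logq x m k k j j = const_theta p x"
proof -
  have 1: "matrix_unit i i k k * matrix_unit i i j j = (0 :: 'n mero)" for i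
    using assms by (auto simp: matrix_unit_def)
  have 2: "matrix_unit i i k k * matrix_unit l l j j = (0 :: 'n mero)" if "i \<in> {1..<l}" for i l
    using assms that by (auto simp: matrix_unit_def)
  have 3: "matrix_unit i l k k * matrix_unit l i j j = (0 :: 'n mero)"
     "matrix_unit l i k k * matrix_unit i l j j = (0 :: 'n mero)" if "i \<in> {1..<l}" for i l
    using assms that by (auto simp: matrix_unit_def)
  have "Rmat idx p logq x m k k j j =
    (\<Sum>l=1..CARD('n). \<Sum>i=1..<l. const_theta p x * (matrix_unit l l k k * matrix_unit i i j j))"
    unfolding Rmat_def 1 mult_zero_right sum.neutral_const add_0_left
    by (intro sum.cong refl) (simp only: 2 3 mult_zero_right add_0_left add_0_right)
  also have "\<dots> = (\<Sum>l=1..CARD('n). if l = k then const_theta p x else 0)"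
  proof (intro sum.cong refl)
    fix l
    have "(\<Sum>i=1..<l. const_theta p x * (matrix_unit l l k k * matrix_unit i i j j)) =
        (\<Sum>i=1..<l. if i = j then (if l = k then const_theta p x else 0) else 0)"
      by (intro sum.cong refl) (auto simp: matrix_unit_def)
    also have "\<dots> = (if l = k then const_theta p x else 0 :: 'n mero)"
      using assms by (subst sum.delta) auto
    finally show "(\<Sum>i=1..<l. const_theta p x * (matrix_unit l l k k * matrix_unit i i j j)) =
        (if l = k then const_theta p x else 0 :: 'n mero)" .
  qed
  also have "\<dots> = const_theta p x"
    using assms by (subst sum.delta) auto
  finally show ?thesis .
qed

lemma multi_index_mono: "m \<le> m' \<Longrightarrow> multi_index m n \<subseteq> multi_index m' n"
  unfolding multi_index_def by (intro PiE_mono) auto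

lemma finite_multi_index: "finite (multi_index m n)"
  unfolding multi_index_def by (intro finite_PiE) auto

lemma multi_indexI_le:
  assumes "\<beta> \<in> multi_index N n" "\<And>a. a \<in> {1..n} \<Longrightarrow> \<beta> a \<le> m"
  shows "\<beta> \<in> multi_index m n"
  using assms unfolding multi_index_def PiE_iff by auto

lemma multi_indexD:
  assumes "\<gamma> \<in> multi_index m n" "a \<in> {1..n}"
  shows "1 \<le> \<gamma> a" "\<gamma> a \<le> m"
  using PiE_mem[OF assms[unfolded multi_index_def]] by auto

lemma comp_list_Nil: "comp_list [] v = v"
  and comp_list_Cons: "comp_list (f # fs) v = f (comp_list fs v)"
  by (simp_all add: comp_list_def)

lemma R_aux_nonzeroD:
  assumes "R_aux idx p logq n logw x i c \<beta> d \<gamma> \<noteq> 0"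
  shows "\<forall>a\<in>{1..n} - {i}. \<beta> a = \<gamma> a"
    and "c = d \<and> \<beta> i = \<gamma> i \<or> c = \<gamma> i \<and> \<beta> i = d"
  using assms Rmat_eq_0 unfolding R_aux_def by (metis (no_types, lifting))+

text \<open>
  The first \<open>i\<close> factors of the product act on the tensor factors \<open>1, \<dots>, i\<close> only.
\<close>

lemma R_prod_untouched:
  assumes "R_prod idx p logq n logw x i c \<beta> d \<gamma> \<noteq> 0" "a \<in> {i<..n}"
  shows "\<beta> a = \<gamma> a"
  using assms
proof (induction i arbitrary: c \<beta>)
  case 0
  then show ?case by (simp split: if_splits)
next
  case (Suc i)
  from Suc.prems(1) obtain e \<delta> where
    "R_aux idx p logq n logw x (Suc i) c \<beta> e \<delta> * R_prod idx p logq n logw x i e \<delta> d \<gamma> \<noteq> 0"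
    unfolding R_prod.simps by (meson sum.not_neutral_contains_not_neutral)
  then have R: "R_aux idx p logq n logw x (Suc i) c \<beta> e \<delta> \<noteq> 0"
    and IH: "R_prod idx p logq n logw x i e \<delta> d \<gamma> \<noteq> 0" by auto
  have "\<delta> a = \<gamma> a"
    using Suc.IH[OF IH] Suc.prems(2) by simp
  moreover have "\<beta> a = \<delta> a"
    using R_aux_nonzeroD(1)[OF R] Suc.prems(2) by auto
  ultimately show ?case by simp
qed

text \<open>
  An auxiliary index \<open>k > m\<close> can only leave the product if it entered it. Followed backwards, it would
  otherwise have to be picked up, by the ice rule, from a tensor factor that still carries its
  initial index, and that index is at most \<open>m\<close>. Hence no exchange takes place at any factor, and every
  factor contributes the entry of \<open>E\<^sub>k\<^sub>k \<otimes> E\<^sub>j\<^sub>j\<close> with \<open>j < k\<close>, which carries no dynamical variables.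
\<close>

lemma R_prod_above:
  fixes idx :: "nat \<Rightarrow> 'n::finite"
  assumes \<gamma>: "\<gamma> \<in> multi_index m n" and k: "m < k" "k \<le> CARD('n)"
    and "\<beta> \<in> multi_index CARD('n) n" "i \<le> n"
  shows "R_prod idx p logq n logw x i k \<beta> d \<gamma> =
    (if d = k \<and> \<beta> = \<gamma> then \<Prod>j=1..i. const_theta p (x - logw j) else 0)"
  using assms(4-)
proof (induction i arbitrary: \<beta>)
  case 0
  then show ?case by auto
next
  case (Suc i)
  let ?Q = "R_aux idx p logq n logw x (Suc i)" and ?P = "R_prod idx p logq n logw x i"
  have i: "Suc i \<in> {1..n}" using Suc.prems by simp
  \<comment> \<open>Only the summand with auxiliary index kept and quantum indices unchanged survives.\<close>
  have *: "?Q k \<beta> e \<delta> * ?P e \<delta> d \<gamma> =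
      (if \<delta> = \<beta> then (if e = k then ?Q k \<beta> k \<beta> * ?P k \<beta> d \<gamma> else 0) else 0)"
    if "\<delta> \<in> multi_index CARD('n) n" for e \<delta>
  proof (cases "?Q k \<beta> e \<delta> = 0 \<or> ?P e \<delta> d \<gamma> = 0")
    case True
    then show ?thesis by auto
  next
    case False
    then have "\<delta> (Suc i) = \<gamma> (Suc i)"
      using R_prod_untouched[of idx p logq n logw x i e \<delta> d \<gamma> "Suc i"] i by auto
    also have "\<dots> < k"
      using multi_indexD(2)[OF \<gamma> i] k by simp
    finally have "e = k" "\<beta> (Suc i) = \<delta> (Suc i)"
      using R_aux_nonzeroD(2)[of idx p logq n logw x "Suc i" k \<beta> e \<delta>] False by auto
    moreover from this have "\<beta> a = \<delta> a" if "a \<in> {1..n}" for a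
      using R_aux_nonzeroD(1)[of idx p logq n logw x "Suc i" k \<beta> e \<delta>] False that by auto
    then have "\<beta> = \<delta>"
      using Suc.prems(1) that unfolding multi_index_def by (intro PiE_ext)
    ultimately show ?thesis by simp
  qed
  have "R_prod idx p logq n logw x (Suc i) k \<beta> d \<gamma> =
    (\<Sum>e=1..CARD('n). \<Sum>\<delta>\<in>multi_index CARD('n) n.
      if \<delta> = \<beta> then (if e = k then ?Q k \<beta> k \<beta> * ?P k \<beta> d \<gamma> else 0) else 0)"
    unfolding R_prod.simps by (intro sum.cong refl *)
  also have "\<dots> = ?Q k \<beta> k \<beta> * ?P k \<beta> d \<gamma>"
    using Suc.prems(1) k by (simp add: finite_multi_index)
  also have "\<dots> = (if d = k \<and> \<beta> = \<gamma> then \<Prod>j=1..Suc i. const_theta p (x - logw j) else 0)"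
  proof (cases "d = k \<and> \<beta> = \<gamma>")
    case True
    have "1 \<le> \<gamma> (Suc i)" "\<gamma> (Suc i) < k"
      using multi_indexD[OF \<gamma> i] k by simp_all
    then have "?Q k \<gamma> k \<gamma> = const_theta p (x - logw (Suc i))"
      unfolding R_aux_def using Rmat_diagonal_gt k by auto
    then show ?thesis
      using Suc.IH[of \<beta>] Suc.prems True by simp
  next
    case False
    then show ?thesis
      using Suc.IH[of \<beta>] Suc.prems by auto
  qed
  finally show ?case .
qed

context
  fixes idx :: "nat \<Rightarrow> 'n::finite" and p logq :: complex
  assumes p: "norm p < 1" and idx: "bij_betw idx {1..CARD('n)} UNIV"
begin

lemma depends_upto_mero_theta:
  assumes "holo_on f UNIV"
    and "\<And>k P. k \<in> {m<..CARD('n)} \<Longrightarrow> f (P + axis (idx k) 1) = f P"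
  shows "depends_upto idx m (mero_theta p f)"
  using assms by (simp add: depends_upto_def mero_shift_mero_theta[OF p])

lemma logPi_shift:
  assumes "i \<in> {1..m}" "j \<in> {1..m}" "k \<in> {m<..CARD('n)}"
  shows "logPi idx logq s i j (P + axis (idx k) 1) = logPi idx logq s i j P"
proof -
  have "idx i \<noteq> idx k" "idx j \<noteq> idx k"
    using assms inj_onD[OF bij_betw_imp_inj_on[OF idx]] by fastforce+
  then show ?thesis
    by (simp add: logPi_def axis_def)
qed

lemma depends_upto_theta_logPi:
  assumes "i \<in> {1..m}" "j \<in> {1..m}"
  shows "depends_upto idx m (mero_theta p (logPi idx logq s i j))"
    and "depends_upto idx m (mero_theta p (\<lambda>P. y + logPi idx logq s i j P))"
    and "depends_upto idx m (mero_theta p (\<lambda>P. y - logPi idx logq s i j P))"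
    and "depends_upto idx m (mero_theta p (\<lambda>P. - logPi idx logq s i j P))"
proof -
  note [intro] = holo_on_logPi holo_on_add holo_on_diff holo_on_const
  have *: "holo_on (\<lambda>P. - logPi idx logq s i j P) UNIV"
    using holo_on_diff[OF holo_on_const[of 0] holo_on_logPi] by simp
  note ls = logPi_shift[OF assms]
  show "depends_upto idx m (mero_theta p (logPi idx logq s i j))"
    by (rule depends_upto_mero_theta) (auto simp: ls)
  show "depends_upto idx m (mero_theta p (\<lambda>P. y + logPi idx logq s i j P))"
    by (rule depends_upto_mero_theta) (auto simp: ls)
  show "depends_upto idx m (mero_theta p (\<lambda>P. y - logPi idx logq s i j P))"
    by (rule depends_upto_mero_theta) (auto simp: ls)
  show "depends_upto idx m (mero_theta p (\<lambda>P. - logPi idx logq s i j P))"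
    by (rule depends_upto_mero_theta[OF *]) (auto simp: ls)
qed

lemma depends_upto_Rmat:
  assumes "d \<le> m" "\<alpha> \<le> m"
  shows "depends_upto idx m (Rmat idx p logq x s c d \<beta> \<alpha>)"
  unfolding Rmat_def
  by (intro depends_upto_add depends_upto_sum depends_upto_matrix_unit;
      intro depends_intros depends_upto_theta_logPi) (use assms in auto)

text \<open>
  If all incoming indices, auxiliary and quantum, are at most \<open>m\<close>, then by the ice rule so are all
  intermediate and outgoing ones, and only \<open>\<Pi>\<^sup>*\<^sub>j\<^sub>,\<^sub>k\<close> with \<open>j, k \<le> m\<close> enter. Both halves are proved in
  one induction because the dynamical variables of the last factor are controlled by the indices
  that leave the previous one.
\<close>

lemma R_prod_below:
  assumes \<gamma>: "\<gamma> \<in> multi_index m n" and d: "d \<le> m" and "i \<le> n"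
  shows "(R_prod idx p logq n logw x i c \<beta> d \<gamma> \<noteq> 0 \<longrightarrow> c \<le> m \<and> (\<forall>a\<in>{1..n}. \<beta> a \<le> m)) \<and>
    depends_upto idx m (R_prod idx p logq n logw x i c \<beta> d \<gamma>)"
  using assms(3)
proof (induction i arbitrary: c \<beta>)
  case 0
  have "\<forall>a\<in>{1..n}. \<gamma> a \<le> m"
    using multi_indexD(2)[OF \<gamma>] by blast
  then show ?case
    using d by (auto intro: depends_intros)
next
  case (Suc i)
  let ?Q = "R_aux idx p logq n logw x (Suc i)" and ?P = "R_prod idx p logq n logw x i"
  have IH: "e \<le> m" "a \<in> {1..n} \<Longrightarrow> \<delta> a \<le> m" if "?P e \<delta> d \<gamma> \<noteq> 0" for e \<delta> a
    using Suc that by auto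
  have dep: "depends_upto idx m (?P e \<delta> d \<gamma>)" for e \<delta>
    using Suc by auto
  have i: "Suc i \<in> {1..n}" using Suc.prems by simp
  have "c \<le> m \<and> (\<forall>a\<in>{1..n}. \<beta> a \<le> m)" if "R_prod idx p logq n logw x (Suc i) c \<beta> d \<gamma> \<noteq> 0"
  proof -
    from that obtain e \<delta> where "?Q c \<beta> e \<delta> * ?P e \<delta> d \<gamma> \<noteq> 0"
      unfolding R_prod.simps by (meson sum.not_neutral_contains_not_neutral)
    then have Q: "?Q c \<beta> e \<delta> \<noteq> 0" and P: "?P e \<delta> d \<gamma> \<noteq> 0" by auto
    note IH' = IH[OF P]
    have "c \<le> m" "\<beta> (Suc i) \<le> m"
      using R_aux_nonzeroD(2)[OF Q] IH'(1) IH'(2)[OF i] by auto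
    moreover have "\<beta> a \<le> m" if "a \<in> {1..n} - {Suc i}" for a
      using R_aux_nonzeroD(1)[OF Q] IH'(2)[of a] that by auto
    ultimately show ?thesis by blast
  qed
  moreover have "depends_upto idx m (?Q c \<beta> e \<delta> * ?P e \<delta> d \<gamma>)" for e \<delta>
  proof (cases "?P e \<delta> d \<gamma> = 0")
    case True
    then show ?thesis by (simp add: depends_intros)
  next
    case False
    then have "depends_upto idx m (?Q c \<beta> e \<delta>)"
      unfolding R_aux_def using IH(1)[OF False] IH(2)[OF False i]
      by (auto intro: depends_upto_Rmat depends_intros)
    then show ?thesis by (intro depends_upto_mult dep)
  qed
  then have "depends_upto idx m (R_prod idx p logq n logw x (Suc i) c \<beta> d \<gamma>)"
    unfolding R_prod.simps by (intro depends_upto_sum)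
  ultimately show ?case by blast
qed

end

section \<open>The L-operators on vectors with bounded indices\<close>

text \<open>
  The restriction on the coefficients is needed because \<open>L\<^sub>k\<^sub>k\<close> also shifts \<open>P\<^sub>k\<close> in them: it is what makes
  \<open>L\<^sub>k\<^sub>k\<close> with \<open>k > m\<close> act by a scalar.
\<close>

definition sector :: "(nat \<Rightarrow> 'n::finite) \<Rightarrow> nat \<Rightarrow> nat \<Rightarrow> 'n vec_rep set" where
  "sector idx n m =
     {v. \<forall>\<mu>. depends_upto idx m (v \<mu>) \<and> (v \<mu> \<noteq> 0 \<longrightarrow> \<mu> \<in> multi_index m n)}"

lemma sector_mono: "m \<le> m' \<Longrightarrow> sector idx n m \<subseteq> sector idx n m'"
  unfolding sector_def using depends_upto_mono multi_index_mono by blast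

lemma vscale_in_sector:
  "v \<in> sector idx n m \<Longrightarrow> vscale (mero_const c) v \<in> sector idx n m"
  by (auto simp: sector_def vscale_def intro: depends_intros)

lemma vscale_vscale:
  "vscale (mero_const a) (vscale (mero_const b) v) = vscale (mero_const (a * b)) v"
  by (simp add: vscale_def mero_const_mult mult.assoc)

lemma vscale_1: "vscale (mero_const 1) v = v"
  by (simp add: vscale_def mero_const_1)

lemma highest_vec_in_sector: "highest_vec n \<in> sector idx n 1"
  by (auto simp: sector_def highest_vec_def multi_index_def intro: depends_intros)

lemma L_op_vscale:
  "L_op idx p logq n logw k l x (vscale (mero_const c) v) =
     vscale (mero_const c) (L_op idx p logq n logw k l x v)"
  by (simp add: L_op_def vscale_def fun_eq_iff mero_shift_mult mero_shift_const sum_distrib_left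
      mult.assoc)

lemma L_op_zero: "L_op idx p logq n logw k l x (\<lambda>_. 0) = (\<lambda>_. 0)"
  by (simp add: L_op_def fun_eq_iff mero_shift_0)

text \<open>
  The row index \<open>k\<close> is the outgoing auxiliary index, so \<open>R_prod_above\<close> forces the column index to be
  \<open>k\<close> as well.
\<close>

lemma L_op_above:
  fixes idx :: "nat \<Rightarrow> 'n::finite"
  assumes v: "v \<in> sector idx n m" and k: "m < k" "k \<le> CARD('n)"
  shows "L_op idx p logq n logw k d x v =
    (if d = k then vscale (mero_const (\<Prod>j=1..n. theta p (x - logw j))) v else (\<lambda>_. 0))"
    (is "_ = ?r")
proof
  fix \<beta>
  show "L_op idx p logq n logw k d x v \<beta> = ?r \<beta>"
  proof (cases "\<beta> \<in> multi_index CARD('n) n")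
    case True
    let ?c = "\<Prod>j=1..n. const_theta p (x - logw j)"
    have "L_op idx p logq n logw k d x v \<beta> =
      (\<Sum>\<alpha>\<in>multi_index CARD('n) n. if \<alpha> = \<beta> then (if d = k then v \<beta> * ?c else 0) else 0)"
      unfolding L_op_def T_op_def using True
    proof (simp only: if_True, intro sum.cong refl)
      fix \<alpha>
      show "mero_shift (axis (idx d) 1) (v \<alpha>) * R_prod idx p logq n logw x n k \<beta> d \<alpha> =
        (if \<alpha> = \<beta> then (if d = k then v \<beta> * ?c else 0) else 0)"
      proof (cases "v \<alpha> = 0")
        case True
        then show ?thesis by (auto simp: mero_shift_0)
      next
        case False
        then have \<alpha>: "\<alpha> \<in> multi_index m n" using v by (simp add: sector_def)
        have "mero_shift (axis (idx k) 1) (v \<alpha>) = v \<alpha>"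
          using v k by (simp add: sector_def depends_upto_def)
        then show ?thesis
          using R_prod_above[where idx = idx, OF \<alpha> k True order_refl] by auto
      qed
    qed
    also have "\<dots> = ?r \<beta>"
      using True
      by (simp add: finite_multi_index vscale_def mero_const_prod const_theta_def mult.commute)
    finally show ?thesis .
  next
    case False
    then have "\<beta> \<notin> multi_index m n"
      using multi_index_mono[of m "CARD('n)" n] k by auto
    then have "v \<beta> = 0" using v by (auto simp: sector_def)
    then show ?thesis using False by (simp add: L_op_def vscale_def)
  qed
qed

lemma L_op_in_sector:
  fixes idx :: "nat \<Rightarrow> 'n::finite"
  assumes p: "norm p < 1" and idx: "bij_betw idx {1..CARD('n)} UNIV"
    and v: "v \<in> sector idx n m" and l: "l \<le> m"
  shows "L_op idx p logq n logw k l x v \<in> sector idx n m"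
proof -
  note below = R_prod_below[OF p idx _ l order_refl]
  have term_dep: "depends_upto idx m (mero_shift a (v \<alpha>) * R_prod idx p logq n logw x n k \<beta> l \<alpha>)"
    for a \<alpha> \<beta>
  proof (cases "v \<alpha> = 0")
    case True
    then show ?thesis by (simp add: mero_shift_0 depends_intros)
  next
    case False
    then have "\<alpha> \<in> multi_index m n" "depends_upto idx m (v \<alpha>)"
      using v by (simp_all add: sector_def)
    then show ?thesis
      using below by (intro depends_upto_mult depends_upto_shift) auto
  qed
  have "\<beta> \<in> multi_index m n" if "L_op idx p logq n logw k l x v \<beta> \<noteq> 0" for \<beta>
  proof -
    from that have \<beta>: "\<beta> \<in> multi_index CARD('n) n"
      and "(\<Sum>\<alpha>\<in>multi_index CARD('n) n.
        mero_shift (axis (idx l) 1) (v \<alpha>) * R_prod idx p logq n logw x n k \<beta> l \<alpha>) \<noteq> 0"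
      unfolding L_op_def T_op_def by (simp_all split: if_splits)
    then obtain \<alpha> where "mero_shift (axis (idx l) 1) (v \<alpha>) \<noteq> 0"
        "R_prod idx p logq n logw x n k \<beta> l \<alpha> \<noteq> 0"
      by (metis (no_types, lifting) mult_eq_0_iff sum.not_neutral_contains_not_neutral)
    moreover from this have "v \<alpha> \<noteq> 0" by (auto simp: mero_shift_0)
    then have "\<alpha> \<in> multi_index m n" using v by (simp add: sector_def)
    ultimately have "\<forall>a\<in>{1..n}. \<beta> a \<le> m" using below by blast
    then show ?thesis using multi_indexI_le[OF \<beta>] by blast
  qed
  moreover have "depends_upto idx m (L_op idx p logq n logw k l x v \<beta>)" for \<beta>
    unfolding L_op_def T_op_def by (auto intro!: depends_upto_sum term_dep depends_upto_0)
  ultimately show ?thesis unfolding sector_def by blast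
qed

section \<open>Quantum minors on vectors with bounded indices\<close>

lemma nth_elem_atLeastAtMost:
  assumes "1 \<le> a" "l + a \<le> N"
  shows "nth_elem {l+1..N} a = l + a"
proof -
  have "sorted_list_of_set {l+1..N} = [l+1..<Suc N]"
    by (simp only: atLeastLessThanSuc_atLeastAtMost[symmetric] sorted_list_of_set_range)
  then show ?thesis using assms by (simp add: nth_elem_def del: upt_Suc)
qed

lemma nth_elem_gap:
  assumes "1 \<le> a" "l + a \<le> N"
  shows "nth_elem ({l} \<union> {l+2..N}) a = (if a = 1 then l else l + a)"
proof -
  have "{l} \<union> {l+2..N} = set (l # [l+2..<Suc N])" by auto
  moreover have "sorted (l # [l+2..<Suc N])" "distinct (l # [l+2..<Suc N])" by (auto simp del: upt_Suc)
  ultimately have "sorted_list_of_set ({l} \<union> {l+2..N}) = l # [l+2..<Suc N]"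
    by (metis sorted_list_of_set.idem_if_sorted_distinct)
  then show ?thesis using assms by (auto simp add: nth_elem_def nth_Cons' simp del: upt_Suc)
qed

text \<open>
  In the term of a permutation \<open>\<sigma>\<close>, the operators act from the bottom row upwards. The bottom row
  index \<open>N\<close> exceeds all indices of the vector, so the operator annihilates the vector unless its column
  index is \<open>N\<close> too, and then it acts by a constant. The same holds for the rows \<open>N - 1, \<dots>, l + 2\<close> in
  turn. So only \<open>\<sigma> = id\<close> contributes, with sign \<open>1\<close>, and leaves the top operator \<open>L\<^sub>l\<^sub>,\<^sub>l\<^sub>+\<^sub>1\<close>.
\<close>

lemma quantum_minor_on_sector:
  fixes idx :: "nat \<Rightarrow> 'n::finite"
  assumes v: "v \<in> sector idx n (l + 1)" and l: "l < CARD('n)"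
  shows "quantum_minor idx p logq n logw ({l} \<union> {l+2..CARD('n)}) {l+1..CARD('n)} x v =
    vscale (mero_const (\<Prod>a=1..CARD('n) - l - 1. \<Prod>j=1..n.
        theta p (x - 2 * of_nat a * logq - logw j)))
      (L_op idx p logq n logw l (l + 1) x v)"
proof -
  define N where "N = CARD('n)"
  define K where "K = N - l"
  define F where "F \<sigma> a = L_op idx p logq n logw (nth_elem ({l} \<union> {l+2..N}) a)
    (nth_elem {l+1..N} (\<sigma> a)) (x - 2 * of_nat (a - 1) * logq)" for \<sigma> a
  define c where "c a = (\<Prod>j=1..n. theta p (x - 2 * of_nat a * logq - logw j))" for a
  have lN: "l < N" using l by (simp add: N_def)
  have card: "card {l+1..N} = K" by (simp add: K_def)
  \<comment> \<open>The operators in the positions \<open>j, \<dots>, K\<close>, that is, in the rows \<open>l + j, \<dots>, N\<close>.\<close>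
  have tail: "comp_list (map (F \<sigma>) [j..<K+1]) v =
      (if \<forall>b\<in>{j..K}. \<sigma> b = b then vscale (mero_const (\<Prod>b=j..K. c (b - 1))) v else (\<lambda>_. 0))"
    if "\<sigma> permutes {1..K}" "2 \<le> j" "j \<le> K + 1" for \<sigma> j
    using that(3,2)
  proof (induction j rule: inc_induct)
    case base
    then show ?case by (simp add: comp_list_Nil vscale_1)
  next
    case (step j)
    have j: "j \<in> {1..K}" "2 \<le> j" using step by auto
    have \<sigma>j: "\<sigma> j \<in> {1..K}" using permutes_in_image[OF that(1)] j by blast
    have F: "F \<sigma> j = L_op idx p logq n logw (l + j) (l + \<sigma> j) (x - 2 * of_nat (j - 1) * logq)"
      using nth_elem_gap[of j l N] nth_elem_atLeastAtMost[of "\<sigma> j" l N] j \<sigma>j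
      by (auto simp: F_def K_def)
    have above: "l + 1 < l + j" "l + j \<le> CARD('n)"
      using j by (auto simp: K_def N_def)
    have split: "{j..K} = insert j {Suc j..K}" using j by auto
    have "comp_list (map (F \<sigma>) [j..<K+1]) v = F \<sigma> j (comp_list (map (F \<sigma>) [Suc j..<K+1]) v)"
      using j by (subst upt_conv_Cons) (auto simp: comp_list_Cons)
    also have "\<dots> = F \<sigma> j (if \<forall>b\<in>{Suc j..K}. \<sigma> b = b
        then vscale (mero_const (\<Prod>b=Suc j..K. c (b - 1))) v else (\<lambda>_. 0))"
      using step.IH j by simp
    also have "\<dots> = (if \<forall>b\<in>{j..K}. \<sigma> b = b
        then vscale (mero_const (\<Prod>b=j..K. c (b - 1))) v else (\<lambda>_. 0))"
      using L_op_above[OF v above]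
      by (auto simp: F L_op_vscale L_op_zero vscale_vscale split c_def mult.commute)
         (simp add: vscale_def)
    finally show ?case .
  qed
  have id: "\<sigma> = id" if \<sigma>: "\<sigma> permutes {1..K}" and fixed: "\<forall>b\<in>{2..K}. \<sigma> b = b" for \<sigma>
  proof -
    have "\<sigma> b = b" if b: "b \<noteq> 1" for b
    proof (cases "b \<in> {1..K}")
      case True
      then show ?thesis using fixed b by simp
    next
      case False
      then show ?thesis using permutes_not_in[OF \<sigma>] by blast
    qed
    moreover from this have "\<sigma> 1 = 1"
      using permutes_inj[OF \<sigma>] by (metis injD)
    ultimately show ?thesis by (metis eq_id_iff)
  qed
  have F_id: "F id 1 = L_op idx p logq n logw l (l + 1) x"
    using nth_elem_gap[of 1 l N] nth_elem_atLeastAtMost[of 1 l N] lN by (simp add: F_def)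
  have F_zero: "F \<sigma> a (\<lambda>_. 0) = (\<lambda>_. 0)" for \<sigma> a
    by (simp only: F_def L_op_zero)
  have full: "comp_list (map (F \<sigma>) [1..<K+1]) v =
      (if \<sigma> = id then vscale (mero_const (\<Prod>b=2..K. c (b - 1)))
         (L_op idx p logq n logw l (l + 1) x v) else (\<lambda>_. 0))"
    if \<sigma>: "\<sigma> permutes {1..K}" for \<sigma>
  proof -
    have "comp_list (map (F \<sigma>) [1..<K+1]) v = F \<sigma> 1 (comp_list (map (F \<sigma>) [2..<K+1]) v)"
      using lN by (subst upt_conv_Cons) (auto simp: comp_list_Cons K_def numeral_2_eq_2)
    also have "comp_list (map (F \<sigma>) [2..<K+1]) v =
      (if \<sigma> = id then vscale (mero_const (\<Prod>b=2..K. c (b - 1))) v else (\<lambda>_. 0))"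
      using tail[OF \<sigma>, of 2] id[OF \<sigma>] lN by (auto simp: K_def)
    finally show ?thesis
      by (cases "\<sigma> = id") (simp_all only: F_id F_zero L_op_vscale if_True if_False simp_thms)
  qed
  have sgn: "dyn_sgn idx p logq J id = 1" for J
    unfolding dyn_sgn_def by (intro prod.neutral) auto
  have "quantum_minor idx p logq n logw ({l} \<union> {l+2..N}) {l+1..N} x v =
      vscale (mero_const (\<Prod>b=2..K. c (b - 1))) (L_op idx p logq n logw l (l + 1) x v)"
    (is "_ = ?r")
  proof
    fix \<mu>
    have "quantum_minor idx p logq n logw ({l} \<union> {l+2..N}) {l+1..N} x v \<mu> =
      (\<Sum>\<sigma> | \<sigma> permutes {1..K}. dyn_sgn idx p logq {l+1..N} \<sigma> *
        comp_list (map (F \<sigma>) [1..<K+1]) v \<mu>)"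
      unfolding quantum_minor_def card F_def ..
    also have "\<dots> = (\<Sum>\<sigma> | \<sigma> permutes {1..K}. if \<sigma> = id then ?r \<mu> else 0)"
    proof (intro sum.cong refl)
      fix \<sigma> assume "\<sigma> \<in> {\<sigma>. \<sigma> permutes {1..K}}"
      then have \<sigma>: "\<sigma> permutes {1..K}" by simp
      show "dyn_sgn idx p logq {l+1..N} \<sigma> * comp_list (map (F \<sigma>) [1..<K+1]) v \<mu> =
          (if \<sigma> = id then ?r \<mu> else 0)"
        unfolding full[OF \<sigma>] by (simp add: sgn)
    qed
    also have "\<dots> = ?r \<mu>"
      using finite_permutations[of "{1..K}"] permutes_id[of "{1..K}"] by simp
    finally show "quantum_minor idx p logq n logw ({l} \<union> {l+2..N}) {l+1..N} x v \<mu> = ?r \<mu>" .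
  qed
  also have "(\<Prod>b=2..K. c (b - 1)) = (\<Prod>a=1..N - l - 1. c a)"
    using lN by (intro prod.reindex_bij_witness[of _ Suc "\<lambda>b. b - 1"]) (auto simp: K_def)
  finally show ?thesis unfolding N_def c_def .
qed

section \<open>Gelfand-Tsetlin vectors\<close>

lemma comp_list_vscale:
  assumes "\<And>t c v. t \<in> set ts \<Longrightarrow>
    B t (vscale (mero_const c) v) = vscale (mero_const c) (B t v)"
  shows "comp_list (map B ts) (vscale (mero_const c) v) =
    vscale (mero_const c) (comp_list (map B ts) v)"
  using assms by (induction ts) (simp_all add: comp_list_Nil comp_list_Cons)

lemma comp_list_scaled:
  assumes "v \<in> sector idx n m"
    and "\<And>t v. t \<in> set ts \<Longrightarrow> v \<in> sector idx n m \<Longrightarrow> B t v \<in> sector idx n m"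
    and "\<And>t v. t \<in> set ts \<Longrightarrow> v \<in> sector idx n m \<Longrightarrow> A t v = vscale (mero_const (c t)) (B t v)"
    and "\<And>t c v. t \<in> set ts \<Longrightarrow>
      B t (vscale (mero_const c) v) = vscale (mero_const c) (B t v)"
  shows "comp_list (map B ts) v \<in> sector idx n m"
    and "comp_list (map A ts) v = vscale (mero_const (\<Prod>t\<leftarrow>ts. c t)) (comp_list (map B ts) v)"
  using assms
  by (induction ts)
    (simp_all add: comp_list_Nil comp_list_Cons vscale_1 vscale_vscale vscale_in_sector mult.commute)

text \<open>
  The operators \<open>L\<^sub>l\<^sub>,\<^sub>l\<^sub>+\<^sub>1(w\<^sub>s)\<close> keep the indices at most \<open>l + 1\<close>, so the comparison of minor and
  \<open>L\<close>-operator can be repeated for each \<open>s \<in> S\<close>; the scalars are constants and pass through the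
  remaining operators.
\<close>

lemma gelfand_tsetlin_step:
  fixes idx :: "nat \<Rightarrow> 'n::finite"
  assumes p: "norm p < 1" and idx: "bij_betw idx {1..CARD('n)} UNIV"
    and v: "v \<in> sector idx n (l + 1)" and l: "l < CARD('n)" and S: "finite S"
  shows "at_w logw (L_op idx p logq n logw l (l + 1)) S v \<in> sector idx n (l + 1)"
    and "at_w logw (quantum_minor idx p logq n logw ({l} \<union> {l+2..CARD('n)}) {l+1..CARD('n)}) S v =
      vscale (mero_const (\<Prod>s\<in>S. \<Prod>a=1..CARD('n) - l - 1. \<Prod>j=1..n.
          theta p (logw s - 2 * of_nat a * logq - logw j)))
        (at_w logw (L_op idx p logq n logw l (l + 1)) S v)"
proof -
  let ?c = "\<lambda>s. \<Prod>a=1..CARD('n) - l - 1. \<Prod>j=1..n.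
          theta p (logw s - 2 * of_nat a * logq - logw j)"
  have prod: "(\<Prod>s\<leftarrow>rev (sorted_list_of_set S). ?c s) = (\<Prod>s\<in>S. ?c s)"
    using S prod.distinct_set_conv_list[of "rev (sorted_list_of_set S)" ?c] by simp
  note scaled = comp_list_scaled[of v idx n "l + 1" "rev (sorted_list_of_set S)"
      "\<lambda>s. L_op idx p logq n logw l (l + 1) (logw s)"
      "\<lambda>s. quantum_minor idx p logq n logw ({l} \<union> {l+2..CARD('n)}) {l+1..CARD('n)} (logw s)" ?c,
      OF v L_op_in_sector[OF p idx] quantum_minor_on_sector[OF _ l] L_op_vscale]
  show "at_w logw (L_op idx p logq n logw l (l + 1)) S v \<in> sector idx n (l + 1)"
    unfolding at_w_def by (rule scaled(1)) auto
  show "at_w logw (quantum_minor idx p logq n logw ({l} \<union> {l+2..CARD('n)}) {l+1..CARD('n)}) S v =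
      vscale (mero_const (\<Prod>s\<in>S. ?c s)) (at_w logw (L_op idx p logq n logw l (l + 1)) S v)"
    unfolding at_w_def prod[symmetric] by (rule scaled(2)) auto
qed

theorem proposition6p5:
  fixes q p logq :: complex
    and n :: nat
    and w logw :: "nat \<Rightarrow> complex"
    and idx :: "nat \<Rightarrow> 'n::finite"
    and I :: "nat \<Rightarrow> nat set"
  assumes "q \<noteq> 0" and "norm q < 1" and "p \<noteq> 0" and "norm p < 1"
    and "\<forall>i\<in>{1..n}. w i \<noteq> 0"
    and "exp logq = q" and "\<forall>i\<in>{1..n}. exp (logw i) = w i"
    and "bij_betw idx {1..CARD('n)} UNIV"
    and "I \<in> ordered_partitions CARD('n) n"
  shows "xi idx p logq n logw I =
    vscale
      (mero_const (\<Prod>j=1..n. \<Prod>l=1..CARD('n) - 1. \<Prod>a=1..CARD('n) - l - 1.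
         \<Prod>s\<in>tail_union CARD('n) I l. theta p (- 2 * of_nat a * logq + logw s - logw j)))
      (xi_tilde idx p logq n logw I)"
proof -
  define N where "N = CARD('n)"
  define S where "S = tail_union N I"
  define A where "A l = at_w logw
    (quantum_minor idx p logq n logw ({l} \<union> {l+2..N}) {l+1..N}) (S l)" for l
  define B where "B l = at_w logw (L_op idx p logq n logw l (l + 1)) (S l)" for l
  define C where "C l = (\<Prod>s\<in>S l. \<Prod>a=1..N - l - 1. \<Prod>j=1..n.
    theta p (logw s - 2 * of_nat a * logq - logw j))" for l
  have N: "N \<ge> 1" by (simp add: N_def Suc_le_eq)
  have finite_S: "finite (S l)" for l
  proof (rule finite_subset)
    show "S l \<subseteq> {1..n}"
      using assms(9) unfolding S_def N_def tail_union_def ordered_partitions_def by fastforce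
  qed simp
  have minors: "B l v \<in> sector idx n (l + 1)" "A l v = vscale (mero_const (C l)) (B l v)"
    if "v \<in> sector idx n (l + 1)" "l < N" for l v
    using gelfand_tsetlin_step[OF assms(4,8) that(1) that(2)[unfolded N_def] finite_S[of l],
        where logw = logw and logq = logq]
    unfolding A_def B_def C_def N_def by auto
  have B_vscale: "B l (vscale (mero_const c) v) = vscale (mero_const c) (B l v)" for l c v
    unfolding B_def at_w_def by (intro comp_list_vscale L_op_vscale)
  \<comment> \<open>After the steps \<open>1, \<dots>, m - 1\<close> the vector has indices at most \<open>m\<close>, as step \<open>m\<close> requires.\<close>
  have "comp_list (map B (rev [1..<m])) (highest_vec n) \<in> sector idx n m \<and>
      comp_list (map A (rev [1..<m])) (highest_vec n) =
        vscale (mero_const (\<Prod>l=1..<m. C l)) (comp_list (map B (rev [1..<m])) (highest_vec n))"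
    if "1 \<le> m" "m \<le> N" for m
    using that
  proof (induction m rule: dec_induct)
    case base
    then show ?case
      using highest_vec_in_sector by (simp add: comp_list_Nil vscale_1)
  next
    case (step m)
    let ?v = "comp_list (map B (rev [1..<m])) (highest_vec n)"
    have v: "?v \<in> sector idx n (m + 1)"
      using step sector_mono[of m "m + 1" idx n] by auto
    have m: "m < N" using step.prems by simp
    have "A m (vscale (mero_const c) ?v) = vscale (mero_const (C m * c)) (B m ?v)" for c
      using minors(2)[OF vscale_in_sector[OF v] m] by (simp add: B_vscale vscale_vscale)
    then show ?case
      using step.IH step.hyps m minors(1)[OF v m] by (simp add: comp_list_Cons mult.commute)
  qed
  from this[OF N order_refl] have "xi idx p logq n logw I =
      vscale (mero_const (\<Prod>l=1..<N. C l)) (xi_tilde idx p logq n logw I)"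
    unfolding xi_def xi_tilde_def A_def B_def S_def N_def by simp
  also have "(\<Prod>l=1..<N. C l) = (\<Prod>l=1..N - 1. \<Prod>j=1..n. \<Prod>a=1..N - l - 1. \<Prod>s\<in>S l.
      theta p (- 2 * of_nat a * logq + logw s - logw j))"
  proof (intro prod.cong)
    fix l
    have "C l = (\<Prod>a=1..N - l - 1. \<Prod>s\<in>S l. \<Prod>j=1..n.
        theta p (- 2 * of_nat a * logq + logw s - logw j))"
      unfolding C_def by (subst prod.swap) (simp add: algebra_simps)
    also have "\<dots> = (\<Prod>a=1..N - l - 1. \<Prod>j=1..n. \<Prod>s\<in>S l.
        theta p (- 2 * of_nat a * logq + logw s - logw j))"
      by (intro prod.cong refl prod.swap)
    also have "\<dots> = (\<Prod>j=1..n. \<Prod>a=1..N - l - 1. \<Prod>s\<in>S l.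
        theta p (- 2 * of_nat a * logq + logw s - logw j))"
      by (rule prod.swap)
    finally show "C l = (\<Prod>j=1..n. \<Prod>a=1..N - l - 1. \<Prod>s\<in>S l.
        theta p (- 2 * of_nat a * logq + logw s - logw j))" .
  qed (use N in auto)
  also have "\<dots> = (\<Prod>j=1..n. \<Prod>l=1..N - 1. \<Prod>a=1..N - l - 1. \<Prod>s\<in>S l.
      theta p (- 2 * of_nat a * logq + logw s - logw j))"
    by (rule prod.swap)
  finally show ?thesis unfolding N_def S_def .
qed

end
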